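(* For every integer $n \ge 5$ there exists a nonassociative unbreakable loop of order $n$. Furthermore: (i) for every odd $n \ge 7$, there exists a commutative unbreakable loop of order $n$ whose multiplication group is the symmetric group $\mathcal{S}_n$, and there exists another commutative unbreakable loop of order $n$ whose multiplication group is the alternating group $\mathcal{A}_n$; (ii) for every even $n \ge 6$, there exists an unbreakable loop of order $n$ whose multiplication group is the symmetric group $\mathcal{S}_n$.
   Context: A loop is a quasigroup with a two-sided identity element: a set $G$ with a binary operation $*$ such that for all $a,b\in G$ the equations $a*x=b$ and $y*a=b$ have unique solutions $x,y \in G$, and such that there is an identity element. All loops are finite, and the order of a loop is its number of elements. A subloop of $G$ is a subset of $G$ that is itself a loop under $*$. A finite loop is unbreakable if its only subloops are itself and the trivial one-element loop. For $a\in G$, the left and right actions of $a$ are the permutations $L_a, R_a$ of $G$ defined by $L_a(b)=a*b$ and $R_a(b)=b*a$. The multiplication group of $G$ is the group of permutations of $G$ generated by $\{L_a, R_a : a\in G\}$. If $G$ has order $n$, its underlying set is taken to be $\{0,1,\ldots,n-1\}$, and the multiplication group is regarded as a subgroup of $\mathcal{S}_n$, the group of all permutations of $\{0,\ldots,n-1\}$; $\mathcal{A}_n$ is the subgroup of all even permutations. *)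

theory Defs
  imports "HOL-Combinatorics.Permutations" "HOL-Algebra.Generated_Groups"
begin

text \<open>
  Loops are structures on an explicit carrier \<open>G\<close>; the values of the operation outside
  \<open>G \<times> G\<close> are irrelevant.
\<close>

locale quasigroup =
  fixes G :: "'a set" and op :: "'a \<Rightarrow> 'a \<Rightarrow> 'a"  (infixl \<open>\<odot>\<close> 70)
  assumes closed: "a \<in> G \<Longrightarrow> b \<in> G \<Longrightarrow> a \<odot> b \<in> G"
    and left_division: "a \<in> G \<Longrightarrow> b \<in> G \<Longrightarrow> \<exists>!x. x \<in> G \<and> a \<odot> x = b"
    and right_division: "a \<in> G \<Longrightarrow> b \<in> G \<Longrightarrow> \<exists>!y. y \<in> G \<and> y \<odot> a = b"

locale loop = quasigroup +
  assumes has_identity: "\<exists>e\<in>G. \<forall>x\<in>G. e \<odot> x = x \<and> x \<odot> e = x"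

definition subloop :: "'a set \<Rightarrow> 'a set \<Rightarrow> ('a \<Rightarrow> 'a \<Rightarrow> 'a) \<Rightarrow> bool"
  where "subloop H G op \<longleftrightarrow> H \<subseteq> G \<and> loop H op"

text \<open>
  A one-element subloop can only consist of the identity, as \<open>x \<odot> x = x\<close> forces \<open>x\<close> to be
  the identity; so the trivial subloop is the one with \<open>card H = 1\<close>.
\<close>

locale unbreakable_loop = loop +
  assumes finite_carrier: "finite G"
    and unbreakable: "subloop H G op \<Longrightarrow> H = G \<or> card H = 1"

definition commutative_on :: "'a set \<Rightarrow> ('a \<Rightarrow> 'a \<Rightarrow> 'a) \<Rightarrow> bool"
  where "commutative_on G op \<longleftrightarrow> (\<forall>a\<in>G. \<forall>b\<in>G. op a b = op b a)"

definition associative_on :: "'a set \<Rightarrow> ('a \<Rightarrow> 'a \<Rightarrow> 'a) \<Rightarrow> bool"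
  where "associative_on G op \<longleftrightarrow>
    (\<forall>a\<in>G. \<forall>b\<in>G. \<forall>c\<in>G. op (op a b) c = op a (op b c))"

text \<open>
  The counterparts, on an arbitrary set \<open>S\<close>, of \<open>sym_group n\<close> and \<open>alt_group n\<close> from
  \<open>HOL-Algebra.Sym_Groups\<close>, which act on \<open>{1..n}\<close>.  The predicate \<open>evenperm\<close> is meaningful
  for finite \<open>S\<close>.
\<close>

definition symmetric_group :: "'a set \<Rightarrow> ('a \<Rightarrow> 'a) monoid"
  where "symmetric_group S = \<lparr> carrier = {p. p permutes S}, monoid.mult = (\<circ>), one = id \<rparr>"

definition alternating_group :: "'a set \<Rightarrow> ('a \<Rightarrow> 'a) monoid"
  where "alternating_group S =
    (symmetric_group S) \<lparr> carrier := {p. p permutes S \<and> evenperm p} \<rparr>"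

text \<open>
  The left and right actions are extended by the identity outside \<open>G\<close>, in accordance with
  \<open>permutes\<close>.
\<close>

definition left_action :: "'a set \<Rightarrow> ('a \<Rightarrow> 'a \<Rightarrow> 'a) \<Rightarrow> 'a \<Rightarrow> 'a \<Rightarrow> 'a"
  where "left_action G op a = (\<lambda>b. if b \<in> G then op a b else b)"

definition right_action :: "'a set \<Rightarrow> ('a \<Rightarrow> 'a \<Rightarrow> 'a) \<Rightarrow> 'a \<Rightarrow> 'a \<Rightarrow> 'a"
  where "right_action G op a = (\<lambda>b. if b \<in> G then op b a else b)"

definition multiplication_group :: "'a set \<Rightarrow> ('a \<Rightarrow> 'a \<Rightarrow> 'a) \<Rightarrow> ('a \<Rightarrow> 'a) monoid"
  where "multiplication_group G op =
    (symmetric_group G) \<lparr> carrier :=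
       generate (symmetric_group G) (left_action G op ` G \<union> right_action G op ` G) \<rparr>"

lemma symmetric_group_is_group: "group (symmetric_group S)"
proof (rule groupI)
  fix p assume "p \<in> carrier (symmetric_group S)"
  then show "\<exists>q\<in>carrier (symmetric_group S). q \<otimes>\<^bsub>symmetric_group S\<^esub> p = \<one>\<^bsub>symmetric_group S\<^esub>"
    by (auto simp: symmetric_group_def intro!: exI[of _ "inv_into UNIV p"] permutes_inv
        permutes_inv_o(2))
qed (auto simp: symmetric_group_def permutes_compose permutes_id comp_assoc)

context quasigroup
begin

lemma left_action_permutes:
  assumes "a \<in> G"
  shows "left_action G op a permutes G"
proof (rule bij_imp_permutes)
  show "bij_betw (left_action G op a) G G"
    unfolding bij_betw_def inj_on_def left_action_def
    using assms closed left_division by (auto simp: image_iff) metis+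
qed (simp add: left_action_def)

lemma right_action_permutes:
  assumes "a \<in> G"
  shows "right_action G op a permutes G"
proof (rule bij_imp_permutes)
  show "bij_betw (right_action G op a) G G"
    unfolding bij_betw_def inj_on_def right_action_def
    using assms closed right_division by (auto simp: image_iff) metis+
qed (simp add: right_action_def)

end

end

theory Submission
  imports Defs
begin

text \<open>
  Every loop below is a principal isotope of a Latin square: rows are labelled by their entries in a
  chosen column \<open>v\<close>, columns by their entries in a chosen row \<open>u\<close>.  The squares are addition tables
  modulo an odd number \<open>m\<close>, extended by a few points at infinity.  Along a few parallels to the diagonal
  the sums are replaced by the new points and moved to the new rows and columns, whose entries are
  therefore affine functions \<open>2 x + c\<close>.

  Choosing \<open>u\<close> and \<open>v\<close> at infinity makes the loops unbreakable for every \<open>m\<close>, prime or not.  If the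
  label of row \<open>x\<close> is \<open>2 x + c\<close>, its square is the entry \<open>2 x + c'\<close> nearby, and the constants can be
  arranged such that squaring is \<open>z \<mapsto> z - 1\<close> or \<open>z \<mapsto> z + 1\<close> with few exceptions.  A subloop with more than
  one element then contains everything (\<open>square_closed_is_everything\<close>) or more than half of the loop,
  which suffices by \<open>subloop_card\<close>.

  The multiplication group of an unbreakable loop is primitive, because the class of the identity under
  an invariant equivalence is a subloop (\<open>invariant_equivalence_trivial\<close>).  Two left translations
  at infinity are multiplied to obtain a transposition (even order) or a 3-cycle (odd order).  Being
  exchanged by a transposition of the group, or lying on a common 3-cycle, is an invariant equivalence,
  so the group contains all transpositions, respectively all even permutations (\<open>transposition_imp_symmetric\<close>,
  \<open>three_cycle_imp_even\<close>).  The same product shows that the loop is not associative: in a group it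
  would be a translation, and a nontrivial translation has no fixed points (\<open>not_associativeI\<close>).

  For odd order it remains to control parities.  All rows at residues are even; the rows at infinity
  involve doubling modulo \<open>m\<close>, whose sign depends on \<open>m\<close>.  Two versions of the square are constructed whose rows at
  infinity have opposite parity.  For each \<open>m\<close> exactly one of them has only even rows: it yields the alternating
  group, the other one the symmetric group.

  The families start at the orders 8 and 13; smaller orders are covered by explicit tables.
\<close>

section \<open>Permutation groups with a 3-cycle or a transposition\<close>

text \<open>
  The notation \<open>inv\<close> belongs to the inverse in a group here.
\<close>

abbreviation perm_inv :: "('a \<Rightarrow> 'a) \<Rightarrow> 'a \<Rightarrow> 'a"
  where "perm_inv \<equiv> inv_into UNIV"

definition three_cycle :: "'a \<Rightarrow> 'a \<Rightarrow> 'a \<Rightarrow> 'a \<Rightarrow> 'a"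
  where "three_cycle x y z = transpose x y \<circ> transpose y z"

lemma three_cycle_apply:
  "distinct [x, y, z] \<Longrightarrow>
    three_cycle x y z w = (if w = x then y else if w = y then z else if w = z then x else w)"
  by (auto simp: three_cycle_def transpose_def)

lemma three_cycle_rotate: "distinct [x, y, z] \<Longrightarrow> three_cycle y z x = three_cycle x y z"
  by (rule ext) (auto simp: three_cycle_def transpose_def)

lemma three_cycle_inverse: "distinct [x, y, z] \<Longrightarrow> perm_inv (three_cycle x y z) = three_cycle y x z"
  by (rule inv_unique_comp) (auto simp: fun_eq_iff three_cycle_def transpose_def)

lemma conjugate_transpose:
  assumes "bij g"
  shows "g \<circ> transpose x y \<circ> perm_inv g = transpose (g x) (g y)"
  using assms
  by (auto simp: fun_eq_iff transpose_def bij_is_surj surj_f_inv_f bij_inv_eq_iff bij_is_inj inj_eq)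

lemma conjugate_three_cycle:
  assumes "bij g"
  shows "g \<circ> three_cycle x y z \<circ> perm_inv g = three_cycle (g x) (g y) (g z)"
proof -
  have "g \<circ> three_cycle x y z \<circ> perm_inv g
      = (g \<circ> transpose x y \<circ> perm_inv g) \<circ> (g \<circ> transpose y z \<circ> perm_inv g)"
    using assms by (simp add: three_cycle_def fun_eq_iff bij_is_inj)
  then show ?thesis
    using assms by (simp add: conjugate_transpose three_cycle_def)
qed

locale permutation_group =
  fixes S :: "'a set" and M :: "('a \<Rightarrow> 'a) set"
  assumes finite_domain: "finite S"
    and permutes: "p \<in> M \<Longrightarrow> p permutes S"
    and id_mem: "id \<in> M"
    and comp_mem: "p \<in> M \<Longrightarrow> q \<in> M \<Longrightarrow> p \<circ> q \<in> M"
    and inv_mem: "p \<in> M \<Longrightarrow> perm_inv p \<in> M"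
begin

lemma bij_mem: "p \<in> M \<Longrightarrow> bij p"
  using permutes permutes_bij by blast

lemma permutation_mem: "p \<in> M \<Longrightarrow> permutation p"
  using permutes finite_domain permutation_permutes by blast

lemma mem_in_domain: "p \<in> M \<Longrightarrow> x \<in> S \<Longrightarrow> p x \<in> S"
  using permutes permutes_in_image by metis

lemma transpose_conj: "g \<in> M \<Longrightarrow> transpose x y \<in> M \<Longrightarrow> transpose (g x) (g y) \<in> M"
  using conjugate_transpose[OF bij_mem, of g x y] by (metis comp_mem inv_mem)

lemma three_cycle_conj:
  "g \<in> M \<Longrightarrow> three_cycle x y z \<in> M \<Longrightarrow> three_cycle (g x) (g y) (g z) \<in> M"
  using conjugate_three_cycle[OF bij_mem, of g x y z] by (metis comp_mem inv_mem)

lemma all_transpositions_imp_all: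
  assumes "\<And>x y. x \<in> S \<Longrightarrow> y \<in> S \<Longrightarrow> transpose x y \<in> M"
    and "p permutes S"
  shows "p \<in> M"
  using assms(2) finite_domain
proof (induction rule: permutes_induct)
  case (swap a b p)
  then show ?case using assms(1) comp_mem by blast
qed (rule id_mem)

lemma three_cycle_turn:
  assumes "distinct [x, y, z]" and "three_cycle x y z \<in> M"
  shows "three_cycle y z x \<in> M" and "three_cycle y x z \<in> M"
  using assms three_cycle_rotate[OF assms(1)] three_cycle_inverse[OF assms(1)] inv_mem
  by metis+

text \<open>
  The relation of lying on a common 3-cycle of the group is an equivalence.  If one cycle
  joins \<open>x\<close> to \<open>y\<close> and another joins \<open>y\<close> to \<open>u\<close>, then conjugating the first by the second, which moves
  \<open>y\<close> to \<open>u\<close> and fixes \<open>x\<close>, joins \<open>x\<close> to \<open>u\<close>.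
\<close>

definition cycle_linked :: "'a \<Rightarrow> 'a \<Rightarrow> bool"
  where "cycle_linked x y \<longleftrightarrow> x = y \<or> (\<exists>z\<in>S. distinct [x, y, z] \<and> three_cycle x y z \<in> M)"

lemma cycle_linked_sym: "x \<in> S \<Longrightarrow> y \<in> S \<Longrightarrow> cycle_linked x y \<Longrightarrow> cycle_linked y x"
  unfolding cycle_linked_def by (metis distinct_length_2_or_more three_cycle_turn(2))

lemma cycle_linked_trans:
  assumes mem: "x \<in> S" "y \<in> S" "u \<in> S"
    and xy: "cycle_linked x y" and yu: "cycle_linked y u"
  shows "cycle_linked x u"
proof (cases "x = y \<or> y = u \<or> x = u")
  case True
  then show ?thesis using xy yu unfolding cycle_linked_def by blast
next
  case False
  then obtain z v where z: "z \<in> S" "distinct [x, y, z]" "three_cycle x y z \<in> M"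
    and v: "v \<in> S" "distinct [y, u, v]" "three_cycle y u v \<in> M"
    using xy yu unfolding cycle_linked_def by blast
  show ?thesis
  proof (cases "v = x")
    case True
    \<comment> \<open>Here the second cycle moves \<open>x\<close> as well, but it already contains both \<open>x\<close> and \<open>u\<close>.\<close>
    have "three_cycle u x y \<in> M"
      using v True three_cycle_turn(1)[of y u v] by simp
    then have "three_cycle x u y \<in> M"
      using v True three_cycle_turn(2)[of u x y] by auto
    moreover have "distinct [x, u, y]"
      using False by auto
    ultimately show ?thesis
      unfolding cycle_linked_def using mem(2) by blast
  next
    case vx: False
    let ?g = "three_cycle y u v"
    have gx: "?g x = x" and gy: "?g y = u"
      using vx False v(2) by (simp_all add: three_cycle_apply[OF v(2)])
    have "three_cycle (?g x) (?g y) (?g z) \<in> M"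
      using v(3) z(3) by (rule three_cycle_conj)
    moreover have "distinct [?g x, ?g y, ?g z]"
      using z bij_is_inj[OF bij_mem[OF v(3)]] by (auto simp: inj_eq)
    moreover have "?g z \<in> S"
      using v(3) z(1) by (rule mem_in_domain)
    ultimately show ?thesis
      unfolding cycle_linked_def gx gy by blast
  qed
qed

lemma cycle_linked_image:
  assumes "g \<in> M" "cycle_linked x y"
  shows "cycle_linked (g x) (g y)"
proof (cases "x = y")
  case False
  then obtain z where "z \<in> S" "distinct [x, y, z]" "three_cycle x y z \<in> M"
    using assms by (auto simp: cycle_linked_def)
  then show ?thesis
    unfolding cycle_linked_def
    using assms three_cycle_conj mem_in_domain bij_is_inj[OF bij_mem[OF assms(1)]]
    by (intro disjI2 bexI[of _ "g z"]) (auto simp: inj_eq)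
qed (simp add: cycle_linked_def)

text \<open>
  Some 3-cycle \<open>(x y z)\<close> exists; conjugating it by a 3-cycle \<open>(z w v)\<close> replaces \<open>z\<close> by the wanted \<open>w\<close>.
  If \<open>v\<close> is \<open>x\<close> or \<open>y\<close>, conjugating by the inverse cycle \<open>(w z v)\<close> does so up to rotation and inversion.
\<close>

lemma all_linked_imp_all_three_cycles:
  assumes linked: "\<And>x y. x \<in> S \<Longrightarrow> y \<in> S \<Longrightarrow> cycle_linked x y"
    and mem: "x \<in> S" "y \<in> S" "w \<in> S" and dist: "distinct [x, y, w]"
  shows "three_cycle x y w \<in> M"
proof -
  obtain z where z: "z \<in> S" "distinct [x, y, z]" "three_cycle x y z \<in> M"
    using linked[OF mem(1,2)] dist by (auto simp: cycle_linked_def)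
  show ?thesis
  proof (cases "z = w")
    case False
    then obtain v where v: "v \<in> S" "distinct [z, w, v]" "three_cycle z w v \<in> M"
      using linked[OF z(1) mem(3)] by (auto simp: cycle_linked_def)
    let ?g = "three_cycle z w v" and ?h = "three_cycle w z v"
    have h: "?h \<in> M"
      using three_cycle_turn(2)[OF v(2,3)] .
    have v': "distinct [w, z, v]" using v(2) by auto
    have g_conj: "three_cycle (?g x) (?g y) (?g z) \<in> M"
      using v(3) z(3) by (rule three_cycle_conj)
    have h_conj: "three_cycle (?h x) (?h y) (?h z) \<in> M"
      using h z(3) by (rule three_cycle_conj)
    consider "v = x" | "v = y" | "v \<noteq> x" "v \<noteq> y" by blast
    then show ?thesis
    proof cases
      case 1
      have "?h x = w" "?h y = y" "?h z = x"
        using 1 z(2) v' dist by (auto simp: three_cycle_apply)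
      then have "three_cycle w y x \<in> M" using h_conj by simp
      then have "three_cycle y w x \<in> M" using dist three_cycle_turn(2)[of w y x] by auto
      then have "three_cycle w x y \<in> M" using dist three_cycle_turn(1)[of y w x] by auto
      then show ?thesis using dist three_cycle_turn(1)[of w x y] by auto
    next
      case 2
      have "?h x = x" "?h y = w" "?h z = y"
        using 2 z(2) v' dist by (auto simp: three_cycle_apply)
      then have "three_cycle x w y \<in> M" using h_conj by simp
      then have "three_cycle w x y \<in> M" using dist three_cycle_turn(2)[of x w y] by auto
      then show ?thesis using dist three_cycle_turn(1)[of w x y] by auto
    next
      case 3
      have "?g x = x" "?g y = y" "?g z = w"
        using 3 z(2) v(2) dist by (auto simp: three_cycle_apply)
      then show ?thesis using g_conj by simp
    qed
  qed (use z in simp)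
qed

text \<open>
  A product of two transpositions is a product of at most two 3-cycles, so a group that contains all
  3-cycles is closed under inserting pairs of transpositions.
\<close>

lemma transpose_pair_mem:
  assumes three: "\<And>x y z. x \<in> S \<Longrightarrow> y \<in> S \<Longrightarrow> z \<in> S \<Longrightarrow> distinct [x, y, z] \<Longrightarrow> three_cycle x y z \<in> M"
    and mem: "a \<in> S" "b \<in> S" "c \<in> S" "d \<in> S" and "a \<noteq> b" "c \<noteq> d"
  shows "transpose a b \<circ> transpose c d \<in> M"
proof -
  have overlap: "transpose x y \<circ> transpose y z \<in> M" if "x \<in> S" "y \<in> S" "z \<in> S" "x \<noteq> y" "y \<noteq> z" for x y z
  proof (cases "x = z")
    case True
    then have "transpose x y \<circ> transpose y z = id"
      by (auto simp: fun_eq_iff transpose_def)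
    then show ?thesis by (simp add: id_mem)
  next
    case False
    then show ?thesis using three[of x y z] that by (simp add: three_cycle_def)
  qed
  show ?thesis
  proof (cases "b = c")
    case True
    then show ?thesis using overlap assms by blast
  next
    case False
    have "transpose a b \<circ> transpose c d
        = (transpose a b \<circ> transpose b c) \<circ> (transpose b c \<circ> transpose c d)"
      by (simp add: fun_eq_iff)
    then show ?thesis
      using overlap[of a b c] overlap[of b c d] assms False comp_mem by metis
  qed
qed

text \<open>
  Induction over a product of transpositions; for odd products the statement is that one more
  transposition leads back into the group.
\<close>

lemma all_three_cycles_imp_even:
  assumes three: "\<And>x y z. x \<in> S \<Longrightarrow> y \<in> S \<Longrightarrow> z \<in> S \<Longrightarrow> distinct [x, y, z] \<Longrightarrow> three_cycle x y z \<in> M"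
    and "p permutes S" "evenperm p"
  shows "p \<in> M"
proof -
  have "(evenperm p \<longrightarrow> p \<in> M) \<and>
    (\<not> evenperm p \<longrightarrow> (\<forall>a\<in>S. \<forall>b\<in>S. a \<noteq> b \<longrightarrow> transpose a b \<circ> p \<in> M))"
    using assms(2) finite_domain
  proof (induction rule: permutes_induct)
    case id
    then show ?case using id_mem by (simp add: id_def)
  next
    case (swap a b p)
    have perm: "permutation p"
      using swap.hyps finite_domain permutation_permutes by blast
    show ?case
    proof (cases "a = b")
      case True
      then show ?thesis using swap by simp
    next
      case False
      then have parity: "evenperm (transpose a b \<circ> p) \<longleftrightarrow> \<not> evenperm p"
        using perm by (simp add: evenperm_comp permutation_swap_id evenperm_swap)
      have "transpose c d \<circ> (transpose a b \<circ> p) \<in> M" if "evenperm p" "c \<in> S" "d \<in> S" "c \<noteq> d" for c d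
      proof -
        have "(transpose c d \<circ> transpose a b) \<circ> p \<in> M"
          using that swap False transpose_pair_mem[OF three] comp_mem by blast
        then show ?thesis by (simp add: comp_assoc)
      qed
      then show ?thesis
        using parity swap.IH swap.hyps False by blast
    qed
  qed
  then show ?thesis using assms by blast
qed

lemma even_and_odd_imp_all:
  assumes even: "\<And>p. p permutes S \<Longrightarrow> evenperm p \<Longrightarrow> p \<in> M"
    and g: "g \<in> M" "\<not> evenperm g" and p: "p permutes S"
  shows "p \<in> M"
proof (cases "evenperm p")
  case False
  have "evenperm (p \<circ> perm_inv g)"
    using False g p permutation_mem[OF g(1)] finite_domain permutation_permutes
    by (metis evenperm_comp evenperm_inv permutation_inverse)
  then have "p \<circ> perm_inv g \<in> M"
    using even p g by (metis inv_mem permutes permutes_compose)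
  then have "(p \<circ> perm_inv g) \<circ> g \<in> M"
    using g comp_mem by blast
  then show ?thesis
    using bij_is_inj[OF bij_mem[OF g(1)]] by (simp add: comp_assoc)
qed (use even p in blast)

end

section \<open>Loops, their subloops and multiplication groups\<close>

lemma symmetric_group_inv:
  assumes "p permutes S"
  shows "inv\<^bsub>symmetric_group S\<^esub> p = perm_inv p"
proof -
  interpret group "symmetric_group S" by (rule symmetric_group_is_group)
  show ?thesis
    by (rule inv_equality)
      (use assms permutes_inv_o in \<open>auto simp: symmetric_group_def permutes_inv\<close>)
qed

lemma quasigroupI:
  assumes "finite G"
    and closed: "\<And>a b. a \<in> G \<Longrightarrow> b \<in> G \<Longrightarrow> op a b \<in> G"
    and left: "\<And>a. a \<in> G \<Longrightarrow> inj_on (op a) G"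
    and right: "\<And>b. b \<in> G \<Longrightarrow> inj_on (\<lambda>a. op a b) G"
  shows "quasigroup G op"
proof
  fix a b assume ab: "a \<in> G" "b \<in> G"
  then show "op a b \<in> G" by (rule closed)
  have "op a ` G = G"
    using ab assms by (intro endo_inj_surj) auto
  then show "\<exists>!x. x \<in> G \<and> op a x = b"
    using left[OF ab(1)] ab(2) unfolding inj_on_def by (metis imageE)
  have "(\<lambda>y. op y a) ` G = G"
    using ab assms by (intro endo_inj_surj) auto
  then show "\<exists>!y. y \<in> G \<and> op y a = b"
    using right[OF ab(1)] ab(2) unfolding inj_on_def by (metis (no_types, lifting) imageE)
qed

context loop
begin

definition mult_perms :: "('a \<Rightarrow> 'a) set"
  where "mult_perms = carrier (multiplication_group G op)"

lemma action_permutes: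
  "f \<in> left_action G op ` G \<union> right_action G op ` G \<Longrightarrow> f permutes G"
  using left_action_permutes right_action_permutes by blast

lemma action_mem:
  "a \<in> G \<Longrightarrow> left_action G op a \<in> mult_perms"
  "a \<in> G \<Longrightarrow> right_action G op a \<in> mult_perms"
  by (auto simp: mult_perms_def multiplication_group_def intro: generate.incl)

lemma mult_perms_permutes:
  assumes "p \<in> mult_perms"
  shows "p permutes G"
proof -
  interpret S: group "symmetric_group G" by (rule symmetric_group_is_group)
  have "p \<in> carrier (symmetric_group G)"
    using assms S.generate_in_carrier[of "left_action G op ` G \<union> right_action G op ` G" p]
      action_permutes
    by (auto simp: mult_perms_def multiplication_group_def symmetric_group_def)
  then show ?thesis by (simp add: symmetric_group_def)
qed

lemma permutation_group_mult_perms: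
  assumes "finite G"
  shows "permutation_group G mult_perms"
proof
  let ?gen = "generate (symmetric_group G) (left_action G op ` G \<union> right_action G op ` G)"
  interpret S: group "symmetric_group G" by (rule symmetric_group_is_group)
  have M: "mult_perms = ?gen"
    by (simp add: mult_perms_def multiplication_group_def)
  show "id \<in> mult_perms"
    using generate.one[of "symmetric_group G"] by (simp add: M symmetric_group_def)
  show "p \<circ> q \<in> mult_perms" if "p \<in> mult_perms" "q \<in> mult_perms" for p q
    using generate.eng[of p "symmetric_group G" _ q] that by (simp add: M symmetric_group_def)
  show "perm_inv p \<in> mult_perms" if "p \<in> mult_perms" for p
    using S.generate_m_inv_closed[of "left_action G op ` G \<union> right_action G op ` G" p] that
      action_permutes mult_perms_permutes[OF that] symmetric_group_inv
    by (force simp: M symmetric_group_def)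
qed (use assms mult_perms_permutes in auto)

text \<open>
  Translates of a proper subloop need not partition the loop, but the translate by any element
  outside the subloop is disjoint from it.
\<close>

lemma subloop_card:
  assumes "finite G" "subloop H G op" "H \<noteq> G"
  shows "2 * card H \<le> card G"
proof -
  interpret H: loop H op using assms by (simp add: subloop_def)
  have sub: "H \<subseteq> G" using assms by (simp add: subloop_def)
  then obtain g where g: "g \<in> G" "g \<notin> H" using assms by blast
  let ?f = "\<lambda>h. op g h"
  have inj: "inj_on ?f H"
    unfolding inj_on_def using g sub left_division closed by (metis subsetD)
  have "?f h \<notin> H" if "h \<in> H" for h
    using H.right_division[OF that, of "op g h"] right_division[of h "op g h"] that g sub closed
    by (metis subsetD)
  then have disj: "H \<inter> ?f ` H = {}" by blast
  have "card H + card (?f ` H) = card (H \<union> ?f ` H)"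
    using disj assms sub by (metis card_Un_disjoint finite_imageI finite_subset)
  also have "\<dots> \<le> card G"
    using sub g closed assms by (intro card_mono) auto
  finally show ?thesis using inj by (simp add: card_image)
qed

end

lemma mult_perms_symmetricI:
  assumes "loop G op" and "\<And>p. p permutes G \<Longrightarrow> p \<in> loop.mult_perms G op"
  shows "multiplication_group G op = symmetric_group G"
proof -
  have "loop.mult_perms G op = {p. p permutes G}"
    using assms loop.mult_perms_permutes[OF assms(1)] by blast
  then show ?thesis
    by (simp add: multiplication_group_def symmetric_group_def loop.mult_perms_def[OF assms(1)])
qed

context unbreakable_loop
begin

sublocale M: permutation_group G mult_perms
  using finite_carrier by (rule permutation_group_mult_perms)

text \<open>
  The class of the identity under an invariant equivalence is a subloop: left and right
  multiplications belong to the group, so they and their inverses preserve the equivalence.  Hence the multiplication group of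
  an unbreakable loop is primitive.
\<close>

lemma invariant_equivalence_trivial:
  assumes refl: "\<And>x. x \<in> G \<Longrightarrow> R x x"
    and sym: "\<And>x y. x \<in> G \<Longrightarrow> y \<in> G \<Longrightarrow> R x y \<Longrightarrow> R y x"
    and trans: "\<And>x y z. x \<in> G \<Longrightarrow> y \<in> G \<Longrightarrow> z \<in> G \<Longrightarrow> R x y \<Longrightarrow> R y z \<Longrightarrow> R x z"
    and invariant: "\<And>g x y. g \<in> mult_perms \<Longrightarrow> x \<in> G \<Longrightarrow> y \<in> G \<Longrightarrow> R x y \<Longrightarrow> R (g x) (g y)"
    and ab: "a \<in> G" "b \<in> G" "a \<noteq> b" "R a b"
    and xy: "x \<in> G" "y \<in> G"
  shows "R x y"
proof -
  obtain e where e: "e \<in> G" "\<And>x. x \<in> G \<Longrightarrow> op e x = x" "\<And>x. x \<in> G \<Longrightarrow> op x e = x"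
    using has_identity by blast
  define H where "H = {x \<in> G. R e x}"
  have left: "R (op c x) (op c y)" if "c \<in> G" "x \<in> G" "y \<in> G" "R x y" for c x y
    using invariant[OF action_mem(1)[OF that(1)] that(2-4)] that by (simp add: left_action_def)
  have left_cancel: "R x y" if "c \<in> G" "x \<in> G" "y \<in> G" "R (op c x) (op c y)" for c x y
    using invariant[OF M.inv_mem[OF action_mem(1)[OF that(1)]] _ _ that(4)] that closed
      permutes_inverses(2)[OF left_action_permutes[OF that(1)]]
    by (metis left_action_def)
  have right_cancel: "R x y" if "c \<in> G" "x \<in> G" "y \<in> G" "R (op x c) (op y c)" for c x y
    using invariant[OF M.inv_mem[OF action_mem(2)[OF that(1)]] _ _ that(4)] that closed
      permutes_inverses(2)[OF right_action_permutes[OF that(1)]]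
    by (metis right_action_def)
  have H_rel: "R x y" if "x \<in> H" "y \<in> H" for x y
  proof -
    have "x \<in> G" "y \<in> G" "R e x" "R e y" using that by (auto simp: H_def)
    then show ?thesis using sym[OF e(1) _ \<open>R e x\<close>] trans[OF _ e(1)] by blast
  qed
  have H_closed: "op x y \<in> H" if "x \<in> H" "y \<in> H" for x y
  proof -
    have "R (op x e) (op x y)"
      using left that e(1) by (simp add: H_def)
    then show ?thesis
      using that trans[of e x "op x y"] e closed by (simp add: H_def)
  qed
  have "loop H op"
  proof
    fix x y assume mem: "x \<in> H" "y \<in> H"
    then have G: "x \<in> G" "y \<in> G" by (auto simp: H_def)
    show "op x y \<in> H" using mem by (rule H_closed)
    obtain z where z: "z \<in> G" "op x z = y" using left_division G by blast
    have "R (op x e) (op x z)" using z e G H_rel[OF mem] by simp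
    then have "z \<in> H" using left_cancel[of x e z] z e G by (simp add: H_def)
    then show "\<exists>!z. z \<in> H \<and> op x z = y"
      using z left_division[OF G] unfolding H_def by blast
    obtain w where w: "w \<in> G" "op w x = y" using right_division G by blast
    have "R (op e x) (op w x)" using w e G H_rel[OF mem] by simp
    then have "w \<in> H" using right_cancel[of x e w] w e G by (simp add: H_def)
    then show "\<exists>!w. w \<in> H \<and> op w x = y"
      using w right_division[OF G] unfolding H_def by blast
  next
    show "\<exists>e\<in>H. \<forall>x\<in>H. op e x = x \<and> op x e = x"
      using e refl by (intro bexI[of _ e]) (auto simp: H_def)
  qed
  then have "H = G \<or> card H = 1"
    using unbreakable by (simp add: subloop_def H_def)
  moreover have "card H \<noteq> 1"
  proof -
    obtain z where z: "z \<in> G" "op a z = b" using left_division ab by blast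
    have "R (op a e) (op a z)" using z ab e by simp
    then have "z \<in> H" using left_cancel[of a e z] z ab e by (simp add: H_def)
    moreover have "z \<noteq> e" using z ab e by auto
    moreover have "e \<in> H" using e refl by (simp add: H_def)
    ultimately show ?thesis by (metis card_1_singletonE singletonD)
  qed
  ultimately show ?thesis using H_rel xy by blast
qed

theorem transposition_imp_symmetric:
  assumes "transpose a b \<in> mult_perms" "a \<in> G" "b \<in> G" "a \<noteq> b"
  shows "multiplication_group G op = symmetric_group G"
proof (rule mult_perms_symmetricI)
  show "loop G op" by (rule loop_axioms)
  have "transpose x y \<in> mult_perms" if "x \<in> G" "y \<in> G" for x y
  proof (rule invariant_equivalence_trivial[where R = "\<lambda>x y. transpose x y \<in> mult_perms"])
    fix x y z assume xy: "transpose x y \<in> mult_perms" and yz: "transpose y z \<in> mult_perms"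
    then show "transpose x z \<in> mult_perms"
      using M.transpose_conj[OF yz xy]
      by (cases "x = z"; cases "x = y") (auto simp: transpose_eq_iff transpose_def[of y z] M.id_mem)
  next
    show "transpose x x \<in> mult_perms" for x
      using M.id_mem by (simp add: id_def)
  qed (use that assms in \<open>auto simp: M.transpose_conj transpose_commute\<close>)
  then show "p \<in> mult_perms" if "p permutes G" for p
    using M.all_transpositions_imp_all that by blast
qed

lemma three_cycle_imp_even:
  assumes "three_cycle a b c \<in> mult_perms" "distinct [a, b, c]" "{a, b, c} \<subseteq> G"
    and "p permutes G" "evenperm p"
  shows "p \<in> mult_perms"
proof -
  have ab: "M.cycle_linked a b"
    using assms by (auto simp: M.cycle_linked_def)
  have "M.cycle_linked x y" if "x \<in> G" "y \<in> G" for x y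
  proof (rule invariant_equivalence_trivial[where R = M.cycle_linked and a = a and b = b])
    show "M.cycle_linked x x" for x by (simp add: M.cycle_linked_def)
    show "M.cycle_linked y x" if "x \<in> G" "y \<in> G" "M.cycle_linked x y" for x y
      using that by (rule M.cycle_linked_sym)
    show "M.cycle_linked x z" if "x \<in> G" "y \<in> G" "z \<in> G" "M.cycle_linked x y" "M.cycle_linked y z" for x y z
      using that by (rule M.cycle_linked_trans)
    show "M.cycle_linked (g x) (g y)" if "g \<in> mult_perms" "M.cycle_linked x y" for g x y
      using that by (rule M.cycle_linked_image)
  qed (use that ab assms(2,3) in auto)
  then show ?thesis
    using M.all_three_cycles_imp_even M.all_linked_imp_all_three_cycles assms(4,5) by blast
qed

theorem three_cycle_odd_imp_symmetric:
  assumes "three_cycle a b c \<in> mult_perms" "distinct [a, b, c]" "{a, b, c} \<subseteq> G"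
    and "g \<in> mult_perms" "\<not> evenperm g"
  shows "multiplication_group G op = symmetric_group G"
  using loop_axioms three_cycle_imp_even[OF assms(1-3)] M.even_and_odd_imp_all assms(4,5)
  by (intro mult_perms_symmetricI) auto

theorem three_cycle_even_imp_alternating:
  assumes "three_cycle a b c \<in> mult_perms" "distinct [a, b, c]" "{a, b, c} \<subseteq> G"
    and even: "\<And>x. x \<in> G \<Longrightarrow> evenperm (left_action G op x) \<and> evenperm (right_action G op x)"
  shows "multiplication_group G op = alternating_group G"
proof -
  have "evenperm p" if "p \<in> mult_perms" for p
  proof -
    have "p \<in> generate (symmetric_group G) (left_action G op ` G \<union> right_action G op ` G)"
      using that by (simp add: mult_perms_def multiplication_group_def)
    then have "p permutes G \<and> evenperm p"
    proof induction
      case one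
      show ?case using permutes_id by (simp add: symmetric_group_def id_def)
    next
      case (incl h)
      then show ?case using action_permutes even by auto
    next
      case (inv h)
      then have "h permutes G" "evenperm h" using action_permutes even by auto
      then have "permutation h"
        using finite_carrier permutation_permutes by blast
      then show ?case
        using \<open>h permutes G\<close> \<open>evenperm h\<close>
        by (simp add: symmetric_group_inv permutes_inv evenperm_inv)
    next
      case (eng h1 h2)
      then have "permutation h1" "permutation h2"
        using finite_carrier permutation_permutes by blast+
      then have "(h1 \<circ> h2) permutes G \<and> evenperm (h1 \<circ> h2)"
        using eng permutes_compose evenperm_comp by metis
      then show ?case by (simp add: symmetric_group_def comp_def)
    qed
    then show ?thesis by simp
  qed
  then have "mult_perms = {p. p permutes G \<and> evenperm p}"
    using mult_perms_permutes three_cycle_imp_even[OF assms(1-3)] by blast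
  then show ?thesis
    by (simp add: multiplication_group_def alternating_group_def mult_perms_def symmetric_group_def)
qed

end

context loop
begin

lemma unbreakable_loopI:
  assumes fin: "finite G" and e: "e \<in> G" "\<And>x. x \<in> G \<Longrightarrow> op e x = x"
    and large: "\<And>H a. e \<in> H \<Longrightarrow> a \<in> H \<Longrightarrow> a \<noteq> e \<Longrightarrow> H \<subseteq> G \<Longrightarrow>
      (\<And>x y. x \<in> H \<Longrightarrow> y \<in> H \<Longrightarrow> op x y \<in> H) \<Longrightarrow> card G < 2 * card H"
  shows "unbreakable_loop G op"
proof
  fix H assume sub: "subloop H G op"
  interpret H: loop H op using sub by (simp add: subloop_def)
  have H_sub: "H \<subseteq> G" using sub by (simp add: subloop_def)
  obtain h where h: "h \<in> H" "\<And>x. x \<in> H \<Longrightarrow> op h x = x"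
    using H.has_identity by blast
  have "h = e"
    using right_division[of h h] h e H_sub by blast
  show "H = G \<or> card H = 1"
  proof (cases "H = {e}")
    case False
    then obtain a where "a \<in> H" "a \<noteq> e" using h(1) by blast
    then have "card G < 2 * card H"
      using large[of H a] h(1) H_sub H.closed \<open>h = e\<close> by blast
    then show ?thesis
      using subloop_card[OF fin sub] by linarith
  qed simp
qed (rule fin)

text \<open>
  In a group a translation with a fixed point is trivial, and a product of two left translations is a
  left translation.
\<close>

lemma not_associativeI:
  assumes "p \<in> G" "q \<in> G" and z: "z \<in> G" "op p (op q z) = z"
    and w: "w \<in> G" "op p (op q w) \<noteq> w"
  shows "\<not> associative_on G op"
proof
  assume assoc: "associative_on G op"
  obtain e where e: "e \<in> G" "\<And>x. x \<in> G \<Longrightarrow> op e x = x"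
    using has_identity by blast
  have "op (op p q) z = z" "op (op p q) w \<noteq> w"
    using assoc assms by (simp_all add: associative_on_def)
  moreover have "op p q = e"
    using right_division[of z z] calculation(1) e z closed[OF assms(1,2)] by blast
  ultimately show False using e w by simp
qed

end

section \<open>Principal isotopes of Latin squares\<close>

locale latin_square =
  fixes Q :: "'a set" and row col :: "'a \<Rightarrow> 'a \<Rightarrow> 'a"
  assumes finite_carrier: "finite Q"
    and row_permutes: "x \<in> Q \<Longrightarrow> row x permutes Q"
    and col_permutes: "y \<in> Q \<Longrightarrow> col y permutes Q"
    and row_col: "x \<in> Q \<Longrightarrow> y \<in> Q \<Longrightarrow> row x y = col y x"
begin

text \<open>
  Labelling each row by its entry in column \<open>v\<close> and each column by its entry in row \<open>u\<close> makes
  \<open>row u v\<close> an identity.  The choice of \<open>u\<close> and \<open>v\<close> controls the squares of the loop: the square of a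
  label \<open>row x v = row u y\<close> is \<open>row x y\<close>.
\<close>

definition isotope :: "'a \<Rightarrow> 'a \<Rightarrow> 'a \<Rightarrow> 'a \<Rightarrow> 'a"
  where "isotope u v a b = row (perm_inv (col v) a) (perm_inv (row u) b)"

lemma row_mem: "x \<in> Q \<Longrightarrow> y \<in> Q \<Longrightarrow> row x y \<in> Q"
  using row_permutes permutes_in_image by metis

lemma isotope_row_row:
  assumes "u \<in> Q" "v \<in> Q" "x \<in> Q" "y \<in> Q"
  shows "isotope u v (row x v) (row u y) = row x y"
  using assms row_col[of x v] permutes_inverses(2)[OF col_permutes]
    permutes_inverses(2)[OF row_permutes]
  by (simp add: isotope_def)

lemma row_label:
  assumes "u \<in> Q" "b \<in> Q"
  obtains y where "y \<in> Q" "b = row u y"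
proof
  show "perm_inv (row u) b \<in> Q" "b = row u (perm_inv (row u) b)"
    using assms permutes_inv[OF row_permutes] permutes_in_image permutes_inverses(1)[OF row_permutes]
    by metis+
qed

lemma col_label:
  assumes "v \<in> Q" "a \<in> Q"
  obtains x where "x \<in> Q" "a = row x v"
proof
  show "perm_inv (col v) a \<in> Q" "a = row (perm_inv (col v) a) v"
    using assms permutes_inv[OF col_permutes] permutes_in_image permutes_inverses(1)[OF col_permutes]
      row_col by metis+
qed

lemma loop_isotope:
  assumes u: "u \<in> Q" and v: "v \<in> Q"
  shows "loop Q (isotope u v)"
proof -
  have "quasigroup Q (isotope u v)"
  proof (rule quasigroupI[OF finite_carrier])
    show "isotope u v a b \<in> Q" if "a \<in> Q" "b \<in> Q" for a b
      using col_label[OF v that(1)] row_label[OF u that(2)] isotope_row_row[OF u v] row_mem by metis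
    show "inj_on (isotope u v a) Q" if a: "a \<in> Q" for a
    proof (rule inj_onI)
      fix b c assume bc: "b \<in> Q" "c \<in> Q" "isotope u v a b = isotope u v a c"
      obtain x where x: "x \<in> Q" "a = row x v" using col_label[OF v a] .
      obtain y where y: "y \<in> Q" "b = row u y" using row_label[OF u bc(1)] .
      obtain z where z: "z \<in> Q" "c = row u z" using row_label[OF u bc(2)] .
      have "row x y = row x z"
        using bc(3) isotope_row_row[OF u v x(1)] x y z by simp
      then show "b = c"
        using permutes_inj[OF row_permutes[OF x(1)]] y z by (simp add: inj_eq)
    qed
    show "inj_on (\<lambda>a. isotope u v a b) Q" if b: "b \<in> Q" for b
    proof (rule inj_onI)
      fix a c assume ac: "a \<in> Q" "c \<in> Q" "isotope u v a b = isotope u v c b"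
      obtain x where x: "x \<in> Q" "a = row x v" using col_label[OF v ac(1)] .
      obtain z where z: "z \<in> Q" "c = row z v" using col_label[OF v ac(2)] .
      obtain y where y: "y \<in> Q" "b = row u y" using row_label[OF u b] .
      have "row x y = row z y"
        using ac(3) isotope_row_row[OF u v _ y(1)] x y z by simp
      then have "col y x = col y z"
        using x y z row_col by simp
      then show "a = c"
        using permutes_inj[OF col_permutes[OF y(1)]] x z by (simp add: inj_eq)
    qed
  qed
  then show ?thesis
  proof (intro loop.intro loop_axioms.intro)
    have "isotope u v (row u v) b = b" if "b \<in> Q" for b
      using row_label[OF u that] isotope_row_row[OF u v u] by metis
    moreover have "isotope u v a (row u v) = a" if "a \<in> Q" for a
      using col_label[OF v that] isotope_row_row[OF u v _ v] by metis
    ultimately show "\<exists>e\<in>Q. \<forall>x\<in>Q. isotope u v e x = x \<and> isotope u v x e = x"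
      using row_mem[OF u v] by blast
  qed
qed

lemma isotope_identity:
  assumes "u \<in> Q" "v \<in> Q" "b \<in> Q"
  shows "isotope u v (row u v) b = b"
  using assms row_label[OF assms(1,3)] isotope_row_row by metis

lemma left_action_isotope:
  assumes "u \<in> Q" "v \<in> Q" "x \<in> Q"
  shows "left_action Q (isotope u v) (row x v) = row x \<circ> perm_inv (row u)"
proof
  fix b
  show "left_action Q (isotope u v) (row x v) b = (row x \<circ> perm_inv (row u)) b"
  proof (cases "b \<in> Q")
    case True
    then obtain y where "y \<in> Q" "b = row u y" using row_label[OF assms(1)] by blast
    then show ?thesis
      using True assms isotope_row_row permutes_inverses(2)[OF row_permutes[OF assms(1)]]
      by (simp add: left_action_def)
  next
    case False
    then show ?thesis
      using permutes_not_in[OF row_permutes[OF assms(3)] False]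
        permutes_not_in[OF permutes_inv[OF row_permutes[OF assms(1)]] False]
      by (simp add: left_action_def)
  qed
qed

text \<open>
  Evaluating a product of left translations directly would require inverting row \<open>u\<close>; on the labels
  \<open>row u y\<close> it only requires finding columns with equal entries.
\<close>

lemma left_actions_compose:
  assumes u: "u \<in> Q" and v: "v \<in> Q" and x: "x \<in> Q" "x' \<in> Q" and g: "g permutes Q"
    and eq: "\<And>y. y \<in> Q \<Longrightarrow> \<exists>y'\<in>Q. row x' y = row u y' \<and> row x y' = g (row u y)"
  shows "left_action Q (isotope u v) (row x v) \<circ> left_action Q (isotope u v) (row x' v) = g"
proof
  fix b
  show "(left_action Q (isotope u v) (row x v) \<circ> left_action Q (isotope u v) (row x' v)) b = g b"
  proof (cases "b \<in> Q")
    case True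
    then obtain y where y: "y \<in> Q" "b = row u y" using row_label[OF u] by blast
    then obtain y' where "y' \<in> Q" "row x' y = row u y'" "row x y' = g (row u y)"
      using eq by blast
    then show ?thesis
      using y permutes_inverses(2)[OF row_permutes[OF u]]
      by (simp add: left_action_isotope u v x)
  next
    case False
    then show ?thesis
      using g by (simp add: left_action_def permutes_not_in)
  qed
qed

end

section \<open>Rotations and doubling\<close>

definition rot :: "nat \<Rightarrow> nat \<Rightarrow> nat \<Rightarrow> nat"
  where "rot m k y = (if y < m then (y + k) mod m else y)"

definition dbl :: "nat \<Rightarrow> nat \<Rightarrow> nat"
  where "dbl m y = (if y < m then (2 * y) mod m else y)"

lemma permutesI_finite:
  assumes "finite S" "\<And>x. x \<in> S \<Longrightarrow> f x \<in> S" "inj_on f S" "\<And>x. x \<notin> S \<Longrightarrow> f x = x"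
  shows "f permutes S"
proof (rule bij_imp_permutes)
  show "bij_betw f S S"
    using assms endo_inj_surj[of S f] by (auto simp: bij_betw_def)
qed (rule assms)

lemma rot_eq: "k \<le> m \<Longrightarrow> rot m k y = (if y < m then if y + k < m then y + k else y + k - m else y)"
  by (auto simp: rot_def mod_if)

lemma dbl_eq: "dbl m y = (if y < m then if 2 * y < m then 2 * y else 2 * y - m else y)"
  by (auto simp: dbl_def mod_if)

lemma rot_permutes:
  assumes "m \<le> n"
  shows "rot m k permutes {..<n}"
proof -
  have mod: "rot m k = rot m (k mod m)"
    by (auto simp: rot_def fun_eq_iff mod_simps)
  have "rot m j permutes {..<n}" if "j \<le> m" for j
  proof (rule permutesI_finite)
    show "inj_on (rot m j) {..<n}"
      using that by (auto simp: inj_on_def rot_eq split: if_splits)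
  qed (use assms that in \<open>auto simp: rot_eq\<close>)
  from this[of "k mod m"] show ?thesis
    by (cases "m = 0") (auto simp: mod rot_def[of 0] fun_eq_iff permutes_def)
qed

lemma dbl_permutes:
  assumes "m \<le> n" "odd m"
  shows "dbl m permutes {..<n}"
proof (rule permutesI_finite)
  show "inj_on (dbl m) {..<n}"
  proof (rule inj_onI)
    fix x y assume "dbl m x = dbl m y"
    then show "x = y"
      using assms by (auto simp: dbl_eq split: if_splits) presburger+
  qed
qed (use assms in \<open>auto simp: dbl_eq\<close>)

text \<open>For odd \<open>m\<close> every rotation is the square of a rotation.\<close>

lemma evenperm_rot:
  assumes "odd m"
  shows "evenperm (rot m k)"
proof -
  have square: "evenperm (rot m (2 * j))" for j
  proof -
    have "rot m (2 * j) = rot m j \<circ> rot m j"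
      by (auto simp: fun_eq_iff rot_def mod_simps add.assoc mult_2)
    moreover have "permutation (rot m j)"
      using rot_permutes[of m m j] permutation_permutes by blast
    ultimately show ?thesis by (simp add: evenperm_comp)
  qed
  have "rot m k = rot m (k + m)" by (auto simp: rot_def fun_eq_iff simp flip: add.assoc)
  then show ?thesis
    using square[of "k div 2"] square[of "(k + m) div 2"] assms
    by (cases "even k") auto
qed

lemma apply_transps_other:
  assumes "y \<notin> fst ` set xs" "y \<notin> snd ` set xs"
  shows "apply_transps xs y = y"
  using assms by (induction xs) (auto simp: transpose_def)

section \<open>The odd family\<close>

text \<open>
  The square has the points \<open>0, \<dots>, m - 1\<close>, added modulo the odd number \<open>m\<close>, and four points at infinity
  \<open>m, \<dots>, m + 3\<close>.  Away from \<open>0\<close> it is the addition table with two changes.  The entry at \<open>{i, i + 1}\<close> is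
  \<open>m\<close> for even \<open>i\<close> and \<open>m + 1\<close> for odd \<open>i\<close>; the entry at \<open>{i, i + 3}\<close> is \<open>m + 2\<close> for even \<open>i\<close> and \<open>m + 3\<close> for
  odd \<open>i\<close>.  The four sums that row \<open>x\<close> loses in this way, \<open>2 x + 1\<close>, \<open>2 x - 1\<close>, \<open>2 x + 3\<close> and \<open>2 x - 3\<close>, are placed
  in the columns at infinity.  In other words, row \<open>x\<close> is the rotation by \<open>x\<close> after exchanging the
  columns \<open>x + 1\<close>, \<open>x - 1\<close>, \<open>x + 3\<close>, \<open>x - 3\<close> with the points at infinity; for odd \<open>x\<close> these points are
  exchanged in pairs as well.  Two layers of changes are needed: a single one would give rows of alternating parity.

  As \<open>m\<close> is odd, the alternation breaks where the residues wrap around.  The rows of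
  \<open>0, 1, 2, m - 3, m - 2, m - 1\<close> and of the points at infinity therefore contain a repaired boundary, found
  by computer search.  There are two repairs, selected by \<open>t\<close>.  Both are symmetric with rows of even
  parity at all residues; they differ in the parity at infinity.

  Storing every row as a list of exchanges makes its bijectivity and its parity evident; the symmetry
  of the square remains to be verified.
\<close>

definition swaps :: "bool \<Rightarrow> nat \<Rightarrow> nat \<Rightarrow> (nat \<times> nat) list"
  where "swaps t m x =
   (
    if x = 0 then
      (if t then [(0, m - 2), (m - 2, m + 3), (m + 3, m + 1), (m + 1, m - 1), (m - 1, m - 3), (m - 3, m), (m, 1), (3, m + 2)]
       else [(0, m - 2), (m - 2, m - 1), (m - 1, m - 3), (m - 3, m), (m, m + 1), (m + 1, m + 3), (m + 3, 1), (3, m + 2)]) else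
    if x = 1 then
      (if t then [(0, m - 1), (m - 1, m), (m, m + 1), (m + 1, m + 2), (m + 2, 4), (4, m + 3)]
       else [(0, m - 1), (m - 1, m), (m, 2), (4, m + 3), (m + 3, m + 2), (m - 2, m + 1)]) else
    if x = 2 then
      (if t then [(3, m), (5, m + 2), (m - 2, m + 1), (m + 1, m - 1)]
       else [(1, m - 1), (m - 1, m - 2), (m - 2, m + 3), (m + 3, m + 1), (3, m), (5, m + 2)]) else
    if x = m - 3 then [(0, m), (m, m - 2), (m - 2, m - 1), (m - 1, m + 2), (m - 6, m + 3), (m - 4, m + 1)] else
    if x = m - 2 then
      (if t then [(0, m + 3), (m + 3, m - 5), (m - 5, m + 2), (m + 2, m), (m, m - 1), (2, m + 1), (m + 1, m - 3), (m - 3, m - 2)]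
       else [(0, 1), (1, m + 1), (m + 1, m - 3), (m - 3, m - 2), (m - 2, 2), (2, m + 3), (m + 3, m - 5), (m - 5, m + 2), (m + 2, m), (m, m - 1)]) else
    if x = m - 1 then [(0, m - 2), (m - 2, m - 1), (m - 1, m - 3), (m - 3, m + 2), (m + 2, 2), (2, 1), (1, m), (m - 4, m + 3)] else
    if x = m then
      (if t then [(1, m + 1), (m, m + 3)]
       else [(0, m + 1), (m, m + 2), (m + 2, m + 3)]) else
    if x = m + 1 then
      (if t then [(1, m + 2), (m + 2, m + 3), (m + 3, m - 1), (m - 1, m + 1), (m + 1, m), (m, 2)]
       else [(0, m + 3), (m + 3, m - 1), (m - 1, m + 1), (m + 1, m), (m, 1)]) else
    if x = m + 2 then
      (if t then [(m - 2, m), (m, m + 2), (m + 2, m + 1), (m + 1, m + 3)]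
       else [(m - 2, m), (m, m + 3), (m + 1, m + 2)]) else
    if x = m + 3 then
      (if t then [(0, m + 1), (1, 2), (2, m + 3), (m + 3, m + 2)]
       else [(0, 2), (2, m + 1), (1, m + 2)]) else
    (if even x then [] else [(m, m + 1), (m + 2, m + 3)])
     @ [(x + 1, m), (x - 1, m + 1), (x + 3, m + 2), (x - 3, m + 3)])"

text \<open>
  At infinity a row is affine: \<open>y\<close> is sent to \<open>2 y + 1\<close>, \<open>2 y - 1\<close>, \<open>2 y + 3\<close> or \<open>2 y - 3\<close>.
\<close>

definition base :: "nat \<Rightarrow> nat \<Rightarrow> nat \<Rightarrow> nat"
  where "base m x =
    (if x = m then rot m 1 \<circ> dbl m
     else if x = m + 1 then rot m (m - 1) \<circ> dbl m
     else if x = m + 2 then rot m 3 \<circ> dbl m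
     else if x = m + 3 then rot m (m - 3) \<circ> dbl m
     else rot m x)"

definition square_row :: "bool \<Rightarrow> nat \<Rightarrow> nat \<Rightarrow> nat \<Rightarrow> nat"
  where "square_row t m x = base m x \<circ> apply_transps (swaps t m x)"

text \<open>
  From here on \<open>m = k + 9\<close> with \<open>k\<close> even: the comparisons between boundary positions such as \<open>2\<close> and
  \<open>m - 3 = k + 6\<close> then become comparisons of numerals.
\<close>

lemma swaps_eval:
  "swaps True (k + 9) (0) = [(0, k + 7), (k + 7, k + 12), (k + 12, k + 10), (k + 10, k + 8), (k + 8, k + 6), (k + 6, k + 9), (k + 9, 1), (3, k + 11)]"
  "swaps False (k + 9) (0) = [(0, k + 7), (k + 7, k + 8), (k + 8, k + 6), (k + 6, k + 9), (k + 9, k + 10), (k + 10, k + 12), (k + 12, 1), (3, k + 11)]"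
  "swaps True (k + 9) (Suc 0) = [(0, k + 8), (k + 8, k + 9), (k + 9, k + 10), (k + 10, k + 11), (k + 11, 4), (4, k + 12)]"
  "swaps False (k + 9) (Suc 0) = [(0, k + 8), (k + 8, k + 9), (k + 9, 2), (4, k + 12), (k + 12, k + 11), (k + 7, k + 10)]"
  "swaps True (k + 9) (2) = [(3, k + 9), (5, k + 11), (k + 7, k + 10), (k + 10, k + 8)]"
  "swaps False (k + 9) (2) = [(1, k + 8), (k + 8, k + 7), (k + 7, k + 12), (k + 12, k + 10), (3, k + 9), (5, k + 11)]"
  "swaps t (k + 9) (k + 6) = [(0, k + 9), (k + 9, k + 7), (k + 7, k + 8), (k + 8, k + 11), (k + 3, k + 12), (k + 5, k + 10)]"
  "swaps True (k + 9) (k + 7) = [(0, k + 12), (k + 12, k + 4), (k + 4, k + 11), (k + 11, k + 9), (k + 9, k + 8), (2, k + 10), (k + 10, k + 6), (k + 6, k + 7)]"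
  "swaps False (k + 9) (k + 7) = [(0, 1), (1, k + 10), (k + 10, k + 6), (k + 6, k + 7), (k + 7, 2), (2, k + 12), (k + 12, k + 4), (k + 4, k + 11), (k + 11, k + 9), (k + 9, k + 8)]"
  "swaps t (k + 9) (k + 8) = [(0, k + 7), (k + 7, k + 8), (k + 8, k + 6), (k + 6, k + 11), (k + 11, 2), (2, 1), (1, k + 9), (k + 5, k + 12)]"
  "swaps True (k + 9) (k + 9) = [(1, k + 10), (k + 9, k + 12)]"
  "swaps False (k + 9) (k + 9) = [(0, k + 10), (k + 9, k + 11), (k + 11, k + 12)]"
  "swaps True (k + 9) (k + 10) = [(1, k + 11), (k + 11, k + 12), (k + 12, k + 8), (k + 8, k + 10), (k + 10, k + 9), (k + 9, 2)]"
  "swaps False (k + 9) (k + 10) = [(0, k + 12), (k + 12, k + 8), (k + 8, k + 10), (k + 10, k + 9), (k + 9, 1)]"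
  "swaps True (k + 9) (k + 11) = [(k + 7, k + 9), (k + 9, k + 11), (k + 11, k + 10), (k + 10, k + 12)]"
  "swaps False (k + 9) (k + 11) = [(k + 7, k + 9), (k + 9, k + 12), (k + 10, k + 11)]"
  "swaps True (k + 9) (k + 12) = [(0, k + 10), (1, 2), (2, k + 12), (k + 12, k + 11)]"
  "swaps False (k + 9) (k + 12) = [(0, 2), (2, k + 10), (1, k + 11)]"
  "3 \<le> x \<Longrightarrow> x < k + 6 \<Longrightarrow> swaps t (k + 9) x =
    (if even x then [] else [(k + 9, k + 10), (k + 11, k + 12)])
    @ [(x + 1, k + 9), (x - 1, k + 10), (x + 3, k + 11), (x - 3, k + 12)]"
  by (simp_all add: swaps_def)

lemma position_cases:
  fixes x k :: nat
  assumes "x < k + 13"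
  obtains "x = 0" | "x = Suc 0" | "x = 2" | "x = k + 6" | "x = k + 7" | "x = k + 8"
    | "x = k + 9" | "x = k + 10" | "x = k + 11" | "x = k + 12" | j where "j < k + 3" "x = j + 3"
proof -
  have "x = 0 \<or> x = Suc 0 \<or> x = 2 \<or> x = k + 6 \<or> x = k + 7 \<or> x = k + 8
    \<or> x = k + 9 \<or> x = k + 10 \<or> x = k + 11 \<or> x = k + 12 \<or> 3 \<le> x \<and> x < k + 6"
    using assms by presburger
  then show thesis
    using that by (elim disjE conjE) (auto dest: le_Suc_ex simp: add.commute)
qed

lemma swaps_range:
  assumes "x < k + 13"
  shows "\<forall>(a, b)\<in>set (swaps t (k + 9) x). a < k + 13 \<and> b < k + 13 \<and> a \<noteq> b"
  using assms by (rule position_cases; cases t) (auto simp: swaps_eval)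

lemma length_swaps:
  assumes "x < k + 13"
  shows "even (length (swaps t (k + 9) x)) \<longleftrightarrow> x < k + 9 \<or> t"
  using assms by (rule position_cases; cases t) (auto simp: swaps_eval)

lemma square_row_permutes:
  assumes "odd m" "m = k + 9" "x < m + 4"
  shows "square_row t m x permutes {..<m + 4}"
proof -
  have "apply_transps (swaps t m x) permutes {..<m + 4}"
    using swaps_range[of x k t] assms by (intro permutes_apply_transps) auto
  moreover have "base m x permutes {..<m + 4}"
    using assms(1) rot_permutes[of m "m + 4"] dbl_permutes[of m "m + 4"]
    by (auto simp: base_def intro: permutes_compose)
  ultimately show ?thesis
    unfolding square_row_def by (rule permutes_compose)
qed

text \<open>
  Whatever the sign of doubling modulo \<open>m\<close> (the Jacobi symbol of \<open>2\<close>), for one of the two values of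
  \<open>t\<close> all rows are even, and for the other one exactly the rows at infinity are odd.
\<close>

lemma evenperm_square_row:
  assumes "odd m" "m = k + 9" "x < m + 4"
  shows "evenperm (square_row t m x) \<longleftrightarrow> x < m \<or> evenperm (dbl m) = t"
proof -
  have rot: "permutation (rot m k)" "evenperm (rot m k)" for k
    using rot_permutes[of m m k] evenperm_rot[OF assms(1)] permutation_permutes by blast+
  have dbl: "permutation (dbl m)"
    using dbl_permutes[of m m] assms permutation_permutes by blast
  have base: "permutation (base m x)"
    using rot(1) dbl by (auto simp: base_def intro: permutation_compose)
  have even_base: "evenperm (base m x) \<longleftrightarrow> x < m \<or> evenperm (dbl m)"
    using assms(3) rot dbl by (auto simp: base_def evenperm_comp)
  have "evenperm (apply_transps (swaps t m x)) \<longleftrightarrow> even (length (swaps t m x))"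
    using swaps_range[of x k t] assms by (intro evenperm_apply_transps_iff) auto
  then show ?thesis
    unfolding square_row_def
    using length_swaps[of x k t] assms(2,3) base even_base by (auto simp: evenperm_comp)
qed

lemma base_eval:
  "base (k + 9) (k + 9) = rot (k + 9) 1 \<circ> dbl (k + 9)"
  "base (k + 9) (k + 10) = rot (k + 9) (k + 8) \<circ> dbl (k + 9)"
  "base (k + 9) (k + 11) = rot (k + 9) 3 \<circ> dbl (k + 9)"
  "base (k + 9) (k + 12) = rot (k + 9) (k + 6) \<circ> dbl (k + 9)"
  "x < k + 9 \<Longrightarrow> base (k + 9) x = rot (k + 9) x"
  by (simp_all add: base_def add.commute)

lemma bulk_transps:
  assumes "j < k + 3" "y < k + 13"
  shows "apply_transps (swaps t (k + 9) (j + 3)) y =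
    (if y = k + 9 then j + 4
     else if y = k + 10 then j + 2
     else if y = k + 11 then j + 6
     else if y = k + 12 then j
     else if y = j + 4 then if odd j then k + 9 else k + 10
     else if y = j + 2 then if odd j then k + 10 else k + 9
     else if y = j + 6 then if odd j then k + 11 else k + 12
     else if y = j then if odd j then k + 12 else k + 11
     else y)"
proof -
  have eval: "swaps t (k + 9) (j + 3) = (if odd j then [] else [(k + 9, k + 10), (k + 11, k + 12)])
    @ [(j + 4, k + 9), (j + 2, k + 10), (j + 6, k + 11), (j, k + 12)]"
    using assms by (simp add: swaps_eval)
  consider "y = k + 9" | "y = k + 10" | "y = k + 11" | "y = k + 12" | "y = j + 4" | "y = j + 2"
    | "y = j + 6" | "y = j" | "y \<notin> {k + 9, k + 10, k + 11, k + 12, j + 4, j + 2, j + 6, j}"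
    by blast
  then show ?thesis
  proof cases
    case 9
    then have "apply_transps (swaps t (k + 9) (j + 3)) y = y"
      by (intro apply_transps_other) (auto simp: eval)
    then show ?thesis using 9 by simp
  qed (use assms in \<open>cases "odd j"; simp add: eval transpose_def\<close>)+
qed

lemma square_row_bulk:
  assumes "j < k + 3" "y < k + 13"
  shows "square_row t (k + 9) (j + 3) y =
    (if y = k + 9 then (2 * j + 7) mod (k + 9)
     else if y = k + 10 then (2 * j + 5) mod (k + 9)
     else if y = k + 11 then (2 * j + 9) mod (k + 9)
     else if y = k + 12 then (2 * j + 3) mod (k + 9)
     else if y = j + 4 then if odd j then k + 9 else k + 10
     else if y = j + 2 then if odd j then k + 10 else k + 9
     else if y = j + 6 then if odd j then k + 11 else k + 12
     else if y = j then if odd j then k + 12 else k + 11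
     else (j + y + 3) mod (k + 9))"
proof -
  let ?r = "rot (k + 9) (j + 3)"
  have bulk: "?r z = (j + z + 3) mod (k + 9)" if "z < k + 9" for z
    using that by (simp add: rot_def add.assoc add.left_commute)
  have inf: "?r (k + 9) = k + 9" "?r (k + 10) = k + 10" "?r (k + 11) = k + 11" "?r (k + 12) = k + 12"
    by (simp_all add: rot_def)
  have near: "?r (j + 4) = (2 * j + 7) mod (k + 9)" "?r (j + 2) = (2 * j + 5) mod (k + 9)"
    "?r (j + 6) = (2 * j + 9) mod (k + 9)" "?r j = (2 * j + 3) mod (k + 9)"
    using assms bulk[of "j + 4"] bulk[of "j + 2"] bulk[of "j + 6"] bulk[of j]
    by (simp_all add: add.commute)
  have row: "square_row t (k + 9) (j + 3) y = ?r (apply_transps (swaps t (k + 9) (j + 3)) y)"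
    using assms by (simp add: square_row_def base_eval)
  consider "y = k + 9" | "y = k + 10" | "y = k + 11" | "y = k + 12" | "y < k + 9"
    using assms by linarith
  then show ?thesis
  proof cases
    case 5
    then show ?thesis
      unfolding row bulk_transps[OF assms] using inf bulk[OF 5] by (simp add: if_distrib[of ?r])
  qed (unfold row bulk_transps[OF assms], use near in simp_all)
qed

lemma square_row_other:
  assumes "y \<notin> fst ` set (swaps t m x)" "y \<notin> snd ` set (swaps t m x)"
  shows "square_row t m x y = base m x y"
  using assms by (simp add: square_row_def apply_transps_other)

lemma square_row_boundary_bulk:
  assumes "j < k + 3"
  shows "square_row t (k + 9) 0 (j + 3) = (if j = 0 then k + 11 else j + 3)"
    and "square_row t (k + 9) (Suc 0) (j + 3) = (if j = 1 then k + 12 else j + 4)"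
    and "square_row t (k + 9) 2 (j + 3) = (if j = 0 then k + 9 else if j = 2 then k + 11 else j + 5)"
    and "square_row t (k + 9) (k + 6) (j + 3) = (if j = k then k + 12 else if j = k + 2 then k + 10 else j)"
    and "square_row t (k + 9) (k + 7) (j + 3) = (if j = k + 1 then k + 11 else j + 1)"
    and "square_row t (k + 9) (k + 8) (j + 3) = (if j = k + 2 then k + 12 else j + 2)"
proof -
  note eval = square_row_def swaps_eval base_eval transpose_def
  show "square_row t (k + 9) 0 (j + 3) = (if j = 0 then k + 11 else j + 3)"
  proof (cases "j = 0")
    case False
    then have "square_row t (k + 9) 0 (j + 3) = base (k + 9) 0 (j + 3)"
      using assms by (intro square_row_other; cases t) (auto simp: swaps_eval)
    then show ?thesis using False assms by (simp add: base_eval rot_eq)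
  qed (cases t; simp add: eval rot_def)
  show "square_row t (k + 9) (Suc 0) (j + 3) = (if j = 1 then k + 12 else j + 4)"
  proof (cases "j = 1")
    case False
    then have "square_row t (k + 9) (Suc 0) (j + 3) = base (k + 9) (Suc 0) (j + 3)"
      using assms by (intro square_row_other; cases t) (auto simp: swaps_eval)
    then show ?thesis using False assms by (simp add: base_eval rot_eq)
  qed (cases t; simp add: eval rot_def)
  show "square_row t (k + 9) 2 (j + 3) = (if j = 0 then k + 9 else if j = 2 then k + 11 else j + 5)"
  proof (cases "j = 0 \<or> j = 2")
    case True
    then show ?thesis by (elim disjE; cases t; simp add: eval rot_def)
  next
    case False
    then have "square_row t (k + 9) 2 (j + 3) = base (k + 9) 2 (j + 3)"
      using assms by (intro square_row_other; cases t) (auto simp: swaps_eval)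
    then show ?thesis using False assms by (simp add: base_eval rot_eq)
  qed
  show "square_row t (k + 9) (k + 6) (j + 3) = (if j = k then k + 12 else if j = k + 2 then k + 10 else j)"
  proof (cases "j = k \<or> j = k + 2")
    case True
    then show ?thesis by (elim disjE; simp add: eval rot_def)
  next
    case False
    then have "square_row t (k + 9) (k + 6) (j + 3) = base (k + 9) (k + 6) (j + 3)"
      using assms by (intro square_row_other) (auto simp: swaps_eval)
    then show ?thesis using False assms by (simp add: base_eval rot_eq)
  qed
  show "square_row t (k + 9) (k + 7) (j + 3) = (if j = k + 1 then k + 11 else j + 1)"
  proof (cases "j = k + 1")
    case False
    then have "square_row t (k + 9) (k + 7) (j + 3) = base (k + 9) (k + 7) (j + 3)"
      using assms by (intro square_row_other; cases t) (auto simp: swaps_eval)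
    then show ?thesis using False assms by (simp add: base_eval rot_eq)
  qed (cases t; simp add: eval rot_def)
  show "square_row t (k + 9) (k + 8) (j + 3) = (if j = k + 2 then k + 12 else j + 2)"
  proof (cases "j = k + 2")
    case False
    then have "square_row t (k + 9) (k + 8) (j + 3) = base (k + 9) (k + 8) (j + 3)"
      using assms by (intro square_row_other) (auto simp: swaps_eval)
    then show ?thesis using False assms by (simp add: base_eval rot_eq)
  qed (simp add: eval rot_def)
qed

lemma square_row_infinity_bulk:
  assumes "j < k + 3"
  shows "square_row t (k + 9) (k + 9) (j + 3) = (2 * j + 7) mod (k + 9)"
    and "square_row t (k + 9) (k + 10) (j + 3) = (2 * j + 5) mod (k + 9)"
    and "square_row t (k + 9) (k + 11) (j + 3) = (2 * j + 9) mod (k + 9)"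
    and "square_row t (k + 9) (k + 12) (j + 3) = (2 * j + 3) mod (k + 9)"
proof -
  have other: "square_row t (k + 9) x (j + 3) = base (k + 9) x (j + 3)"
    if "x \<in> {k + 9, k + 10, k + 11, k + 12}" for x
    using assms that by (intro square_row_other; cases t) (auto simp: swaps_eval)
  have rot_dbl: "(rot (k + 9) i \<circ> dbl (k + 9)) (j + 3) = (2 * (j + 3) + i) mod (k + 9)" for i
    using assms by (simp add: rot_def dbl_def mod_simps)
  have "2 * (j + 3) + (k + 8) = 2 * j + 5 + (k + 9)" "2 * (j + 3) + (k + 6) = 2 * j + 3 + (k + 9)"
    "2 * (j + 3) + 1 = 2 * j + 7" "2 * (j + 3) + 3 = 2 * j + 9"
    by simp_all
  then show "square_row t (k + 9) (k + 9) (j + 3) = (2 * j + 7) mod (k + 9)"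
    "square_row t (k + 9) (k + 10) (j + 3) = (2 * j + 5) mod (k + 9)"
    "square_row t (k + 9) (k + 11) (j + 3) = (2 * j + 9) mod (k + 9)"
    "square_row t (k + 9) (k + 12) (j + 3) = (2 * j + 3) mod (k + 9)"
    by (simp_all only: other base_eval rot_dbl insert_iff simp_thms mod_add_self2)
qed

lemma square_row_boundary_sym:
  assumes "x \<in> {0, Suc 0, 2, k + 6, k + 7, k + 8, k + 9, k + 10, k + 11, k + 12}"
    and "y \<in> {0, Suc 0, 2, k + 6, k + 7, k + 8, k + 9, k + 10, k + 11, k + 12}"
  shows "square_row t (k + 9) x y = square_row t (k + 9) y x"
  using assms
  by (elim insertE emptyE; cases t)
    (simp_all add: square_row_def swaps_eval base_eval transpose_def rot_eq dbl_eq)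

lemma square_row_sym:
  assumes k: "even k" and xy: "x < k + 13" "y < k + 13"
  shows "square_row t (k + 9) x y = square_row t (k + 9) y x"
proof -
  let ?B = "{0, Suc 0, 2, k + 6, k + 7, k + 8, k + 9, k + 10, k + 11, k + 12}"
  have mixed: "square_row t (k + 9) z (j + 3) = square_row t (k + 9) (j + 3) z"
    if "j < k + 3" "z \<in> ?B" for j z
    using that(2)
    apply (elim insertE emptyE)
    using that(1) k
    by (auto simp: square_row_bulk square_row_boundary_bulk square_row_infinity_bulk mod_if)
  have bulk: "square_row t (k + 9) (i + 3) (j + 3) = square_row t (k + 9) (j + 3) (i + 3)"
    if "i < k + 3" "j < k + 3" for i j
    using that by (auto simp: square_row_bulk add.commute)
  show ?thesis
    using xy(1)
  proof (rule position_cases)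
    fix i assume i: "i < k + 3" "x = i + 3"
    show ?thesis using xy(2) by (rule position_cases) (simp_all add: i mixed bulk)
  qed (use xy(2) in \<open>rule position_cases; simp add: mixed square_row_boundary_sym\<close>)+
qed

section \<open>Squares and a 3-cycle\<close>

text \<open>
  In the loop with \<open>u = v = m\<close> the square of the label in column \<open>y\<close> of row \<open>m\<close> is the diagonal entry at
  \<open>y\<close>.  For almost all \<open>y\<close> these entries are \<open>2 y + 1\<close> and \<open>2 y\<close>, so squaring lowers a residue by one.
\<close>

lemma square_row_middle:
  assumes "even k" "2 \<le> y" "y \<le> k + 6"
  shows "square_row t (k + 9) (k + 9) y = (2 * y + 1) mod (k + 9)"
    and "square_row t (k + 9) y y = (2 * y) mod (k + 9)"
proof -
  have "y < k + 13" using assms by simp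
  then have "square_row t (k + 9) (k + 9) y = (2 * y + 1) mod (k + 9) \<and>
    square_row t (k + 9) y y = (2 * y) mod (k + 9)"
  proof (rule position_cases)
    fix j assume "j < k + 3" "y = j + 3"
    then show ?thesis
      by (simp add: square_row_bulk square_row_infinity_bulk algebra_simps)
  qed (use assms in \<open>cases t; simp add: square_row_def swaps_eval base_eval transpose_def rot_eq dbl_eq mod_if\<close>)+
  then show "square_row t (k + 9) (k + 9) y = (2 * y + 1) mod (k + 9)"
    "square_row t (k + 9) y y = (2 * y) mod (k + 9)" by simp_all
qed

text \<open>
  Squaring is a single cycle on the elements other than the identity: it descends from \<open>m - 4\<close> to \<open>3\<close> and
  returns from \<open>3\<close> to \<open>m - 4\<close> through the boundary residues and the points at infinity.  That return path is the
  list of implications \<open>walk\<close>.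
\<close>

lemma square_closed_is_everything:
  assumes k: "even k"
    and closed: "\<And>y. y < k + 13 \<Longrightarrow> square_row t (k + 9) (k + 9) y \<in> H \<Longrightarrow> square_row t (k + 9) y y \<in> H"
    and z: "z \<in> H" "z < k + 13" "z \<noteq> square_row t (k + 9) (k + 9) (k + 9)"
    and w: "w < k + 13" "w \<noteq> square_row t (k + 9) (k + 9) (k + 9)"
  shows "w \<in> H"
proof -
  have halve: "x - 1 \<in> H" if "x \<in> H" "2 * y + 1 = x \<or> 2 * y + 1 = x + (k + 9)"
    "2 \<le> y" "y \<le> k + 6" "0 < x" "x < k + 9" for x y
  proof -
    have "2 * y = x - 1 \<or> 2 * y = x - 1 + (k + 9)" using that by linarith
    then have "(2 * y + 1) mod (k + 9) = x" "(2 * y) mod (k + 9) = x - 1"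
      using that by (elim disjE; simp only: mod_add_self2; simp)+
    then show ?thesis
      using closed[of y] square_row_middle[OF k that(3,4), of t] that by simp
  qed
  have pred_odd: "x - 1 \<in> H" if x: "x \<in> H" "odd x" "5 \<le> x" "x < k + 9" for x
  proof -
    obtain y where "x = 2 * y + 1" using x(2) by (elim oddE)
    then show ?thesis using halve[of x y] x by simp
  qed
  have pred_even: "x - 1 \<in> H" if x: "x \<in> H" "even x" "2 \<le> x" "x < k + 5" for x
  proof -
    obtain y where "x + k + 8 = 2 * y" using k x(2) by (metis dvd_def even_add even_numeral)
    then show ?thesis using halve[of x y] x by simp
  qed
  have pred: "x - 1 \<in> H" if "x \<in> H" "4 \<le> x" "x < k + 6" for x
  proof (cases "even x")
    case True
    then have "x < k + 5" using k that by presburger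
    then show ?thesis using pred_even True that by simp
  next
    case False
    then have "5 \<le> x" using that by presburger
    then show ?thesis using pred_odd False that by simp
  qed
  have zero: "k + 8 \<in> H" if "0 \<in> H"
  proof -
    obtain y where y: "k + 8 = 2 * y" using k by (metis dvd_def even_add even_numeral)
    then have "(2 * y + 1) mod (k + 9) = 0" "(2 * y) mod (k + 9) = k + 8"
      by (simp_all add: add.commute flip: y)
    then show ?thesis
      using closed[of y] square_row_middle[OF k, of y t] that y by simp
  qed
  have down: "x \<in> H" if "y \<in> H" "y < k + 6" "3 \<le> x" "x \<le> y" for x y
    using that(4,3,1,2)
  proof (induction rule: inc_induct)
    case (step n)
    then show ?case using pred[of "Suc n"] by simp
  qed simp
  note eval = square_row_def swaps_eval base_eval transpose_def rot_eq dbl_eq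
  note steps = closed[of 0] closed[of "Suc 0"] closed[of "k + 7"] closed[of "k + 8"]
     closed[of "k + 10"] closed[of "k + 11"] closed[of "k + 12"]
     pred_odd[of "k + 7"] pred_even[of 2] zero
  show ?thesis
  proof (cases t)
    case True
    have identity: "square_row t (k + 9) (k + 9) (k + 9) = k + 12"
      using True by (simp add: eval)
    have walk: "3 \<in> H \<Longrightarrow> k + 9 \<in> H" "k + 9 \<in> H \<Longrightarrow> k + 11 \<in> H" "k + 11 \<in> H \<Longrightarrow> k + 10 \<in> H" "k + 10 \<in> H \<Longrightarrow> 2 \<in> H" "2 \<in> H \<Longrightarrow> Suc 0 \<in> H" "Suc 0 \<in> H \<Longrightarrow> k + 7 \<in> H" "k + 7 \<in> H \<Longrightarrow> k + 6 \<in> H" "k + 6 \<in> H \<Longrightarrow> 0 \<in> H" "0 \<in> H \<Longrightarrow> k + 8 \<in> H" "k + 8 \<in> H \<Longrightarrow> k + 5 \<in> H"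
      using steps True k by (simp_all add: eval add.commute) (simp_all add: numeral_2_eq_2 numeral_3_eq_3)
    have "3 \<in> H"
      using z(2) 
    proof (rule position_cases)
      fix j assume "j < k + 3" "z = j + 3"
      then show ?thesis using down[of z 3] z(1) by simp
    qed (use z walk identity down[of "k + 5" 3] in simp_all)
    then have all: "3 \<in> H" "k + 9 \<in> H" "k + 11 \<in> H" "k + 10 \<in> H" "2 \<in> H" "Suc 0 \<in> H" "k + 7 \<in> H" "k + 6 \<in> H" "0 \<in> H" "k + 8 \<in> H" "k + 5 \<in> H"
      using walk by blast+
    have "w \<in> H"
      using w(1)
    proof (rule position_cases)
      fix j assume "j < k + 3" "w = j + 3"
      then show ?thesis using down[of "k + 5" w] all by simp
    qed (use w(2) all identity in simp_all)
    then show ?thesis .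
  next
    case False
    have identity: "square_row t (k + 9) (k + 9) (k + 9) = k + 11"
      using False by (simp add: eval)
    have walk: "3 \<in> H \<Longrightarrow> 2 \<in> H" "2 \<in> H \<Longrightarrow> Suc 0 \<in> H" "Suc 0 \<in> H \<Longrightarrow> k + 9 \<in> H" "k + 9 \<in> H \<Longrightarrow> k + 12 \<in> H" "k + 12 \<in> H \<Longrightarrow> k + 10 \<in> H" "k + 10 \<in> H \<Longrightarrow> k + 7 \<in> H" "k + 7 \<in> H \<Longrightarrow> k + 6 \<in> H" "k + 6 \<in> H \<Longrightarrow> 0 \<in> H" "0 \<in> H \<Longrightarrow> k + 8 \<in> H" "k + 8 \<in> H \<Longrightarrow> k + 5 \<in> H"
      using steps False k by (simp_all add: eval add.commute) (simp_all add: numeral_2_eq_2 numeral_3_eq_3)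
    have "3 \<in> H"
      using z(2) 
    proof (rule position_cases)
      fix j assume "j < k + 3" "z = j + 3"
      then show ?thesis using down[of z 3] z(1) by simp
    qed (use z walk identity down[of "k + 5" 3] in simp_all)
    then have all: "3 \<in> H" "2 \<in> H" "Suc 0 \<in> H" "k + 9 \<in> H" "k + 12 \<in> H" "k + 10 \<in> H" "k + 7 \<in> H" "k + 6 \<in> H" "0 \<in> H" "k + 8 \<in> H" "k + 5 \<in> H"
      using walk by blast+
    have "w \<in> H"
      using w(1)
    proof (rule position_cases)
      fix j assume "j < k + 3" "w = j + 3"
      then show ?thesis using down[of "k + 5" w] all by simp
    qed (use w(2) all identity in simp_all)
    then show ?thesis .
  qed
qed

text \<open>
  The rows at infinity are affine with the same slope, so the column \<open>y + 1\<close> of row \<open>m\<close> has the entry of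
  column \<open>y\<close> in row \<open>m + 2\<close>, and row \<open>m + 1\<close> has in column \<open>y + 1\<close> the entry \<open>2 y + 1\<close> with which row \<open>m\<close> started.
  Hence the product of the left translations belonging to the rows \<open>m + 1\<close> and \<open>m + 2\<close> moves only a few boundary
  labels; the chosen repairs leave exactly three.
\<close>

lemma square_row_three_cycle:
  assumes k: "even k" and y: "y < k + 13"
  shows "\<exists>y'<k + 13. square_row t (k + 9) (k + 11) y = square_row t (k + 9) (k + 9) y' \<and>
    square_row t (k + 9) (k + 10) y' =
      three_cycle (if t then Suc 0 else k + 8) (k + 9) (k + 10) (square_row t (k + 9) (k + 9) y)"
proof -
  note eval = square_row_def swaps_eval base_eval transpose_def rot_eq dbl_eq three_cycle_apply
  show ?thesis
    using y
  proof (rule position_cases)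
    fix j assume j: "j < k + 3" "y = j + 3"
    have unmoved: "three_cycle (if t then Suc 0 else k + 8) (k + 9) (k + 10) ((2 * j + 7) mod (k + 9))
        = (2 * j + 7) mod (k + 9)"
    proof -
      define z where "z = (2 * j + 7) mod (k + 9)"
      have "z < k + 9" "z = 2 * j + 7 \<or> z + (k + 9) = 2 * j + 7"
        using j(1) by (auto simp: z_def mod_if)
      \<comment> \<open>Either \<open>z = 2 j + 7\<close> is odd and at least 7, or \<open>z\<close> is even and at most \<open>k + 2\<close>.\<close>
      then have "z \<noteq> Suc 0 \<and> z \<noteq> k + 8 \<and> z \<noteq> k + 9 \<and> z \<noteq> k + 10"
        using k j(1) by presburger
      then have "three_cycle (if t then Suc 0 else k + 8) (k + 9) (k + 10) z = z"
        by (simp add: three_cycle_apply)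
      then show ?thesis by (simp add: z_def)
    qed
    show ?thesis
    proof (cases "j = k + 2")
      case True
      then have "square_row t (k + 9) (k + 9) (k + 6) = (2 * j + 9) mod (k + 9)"
        "square_row t (k + 9) (k + 10) (k + 6) = (2 * j + 7) mod (k + 9)"
        by (cases t; simp add: eval mod_if)+
      then show ?thesis
        using j unmoved by (intro exI[of _ "k + 6"]) (simp add: square_row_infinity_bulk)
    next
      case False
      have "2 * (j + 1) + 7 = 2 * j + 9" "2 * (j + 1) + 5 = 2 * j + 7" by simp_all
      then show ?thesis
        using j unmoved False square_row_infinity_bulk[of j k t] square_row_infinity_bulk[of "j + 1" k t]
        by (intro exI[of _ "j + 1 + 3"]) (simp add: add.commute)
    qed
  next
    show ?thesis if "y = 0"
      using that k by (cases t; intro exI[of _ "if t then k + 10 else 1"]) (simp_all add: eval)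
    show ?thesis if "y = Suc 0"
      using that k by (cases t; intro exI[of _ "if t then 2 else 2"]) (simp_all add: eval)
    show ?thesis if "y = 2"
      using that k by (cases t; intro exI[of _ "if t then 3 else 3"]) (simp_all add: eval)
    show ?thesis if "y = k + 6"
      using that k by (cases t; intro exI[of _ "if t then k + 7 else k + 7"]) (simp_all add: eval)
    show ?thesis if "y = k + 7"
      using that k by (cases t; intro exI[of _ "if t then k + 12 else k + 12"]) (simp_all add: eval)
    show ?thesis if "y = k + 8"
      using that k by (cases t; intro exI[of _ "if t then 0 else k + 10"]) (simp_all add: eval)
    show ?thesis if "y = k + 9"
      using that k by (cases t; intro exI[of _ "if t then k + 11 else k + 11"]) (simp_all add: eval)
    show ?thesis if "y = k + 10"
      using that k by (cases t; intro exI[of _ "if t then k + 9 else k + 9"]) (simp_all add: eval)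
    show ?thesis if "y = k + 11"
      using that k by (cases t; intro exI[of _ "if t then 1 else 0"]) (simp_all add: eval)
    show ?thesis if "y = k + 12"
      using that k by (cases t; intro exI[of _ "if t then k + 8 else k + 8"]) (simp_all add: eval)
  qed
qed

text \<open>
  Left translations are quotients of two rows, so they are all even exactly if the rows have equal parity.
\<close>

theorem odd_loop_exists:
  assumes k: "even k"
  defines "n \<equiv> k + 13"
  obtains op where "unbreakable_loop {..<n} op" "commutative_on {..<n} op"
    "\<not> associative_on {..<n} op"
    "multiplication_group {..<n} op =
      (if t = evenperm (dbl (k + 9)) then alternating_group {..<n} else symmetric_group {..<n})"
proof -
  define row where "row = square_row t (k + 9)"
  define u where "u = k + 9"
  define a where "a = (if t then Suc 0 else k + 8)"
  have odd: "odd (k + 9)" using k by simp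
  have permutes: "row x permutes {..<n}" if "x < n" for x
    using square_row_permutes[OF odd refl, of x t] that by (simp add: n_def row_def add.commute)
  have sym: "row x y = row y x" if "x < n" "y < n" for x y
    using square_row_sym[OF k] that by (simp add: n_def row_def)
  interpret latin_square "{..<n}" row row
    by standard (use permutes sym in auto)
  have u: "u \<in> {..<n}" by (simp add: u_def n_def)
  define op where "op = isotope u u"
  define e where "e = row u u"
  interpret loop "{..<n}" op
    unfolding op_def using u u by (rule loop_isotope)
  have label: "\<exists>x\<in>{..<n}. p = row u x" if "p \<in> {..<n}" for p
    using row_label[OF u that] by metis
  have op_row: "op (row u x) (row u y) = row x y" if "x < n" "y < n" for x y
    using isotope_row_row[OF u u, of x y] sym[of x u] that u by (simp add: op_def)
  have comm: "commutative_on {..<n} op"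
    unfolding commutative_on_def using label op_row sym by (metis lessThan_iff)
  have e: "e \<in> {..<n}" "\<And>x. x \<in> {..<n} \<Longrightarrow> op e x = x"
    using row_mem[OF u u] isotope_identity[OF u u] by (simp_all add: e_def op_def)
  interpret unbreakable_loop "{..<n}" op
  proof (rule unbreakable_loopI[OF _ e])
    fix H z assume H: "e \<in> H" "z \<in> H" "z \<noteq> e" "H \<subseteq> {..<n}"
      and closed: "\<And>x y. x \<in> H \<Longrightarrow> y \<in> H \<Longrightarrow> op x y \<in> H"
    have squares: "square_row t (k + 9) y y \<in> H"
      if "y < k + 13" "square_row t (k + 9) (k + 9) y \<in> H" for y
    proof -
      have y: "y < n" "row u y \<in> H" using that by (simp_all only: n_def row_def u_def)
      have "op (row u y) (row u y) \<in> H" using y(2) by (intro closed)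
      then have "row y y \<in> H" by (simp only: op_row[OF y(1) y(1)])
      then show ?thesis by (simp only: row_def)
    qed
    have "w \<in> H" if w: "w < n" for w
    proof (cases "w = e")
      case False
      show ?thesis
        using squares H(2)
        by (rule square_closed_is_everything[OF k, where z = z])
          (use H(3,4) \<open>z \<in> H\<close> w False in \<open>auto simp only: e_def row_def u_def n_def\<close>)
    qed (use H(1) in simp)
    then have "H = {..<n}" using H(4) by blast
    then show "card {..<n} < 2 * card H" by (simp add: n_def)
  qed simp_all
  have a: "distinct [a, u, k + 10]" "{a, u, k + 10} \<subseteq> {..<n}"
    by (auto simp: a_def u_def n_def)
  have perm: "three_cycle a u (k + 10) permutes {..<n}"
    using a(2) by (simp add: three_cycle_def permutes_compose permutes_swap_id)
  have product: "left_action {..<n} op (row (k + 10) u) \<circ> left_action {..<n} op (row (k + 11) u)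
      = three_cycle a u (k + 10)"
    unfolding op_def
  proof (rule left_actions_compose[OF u u _ _ perm])
    fix y assume "y \<in> {..<n}"
    then show "\<exists>y'\<in>{..<n}. row (k + 11) y = row u y' \<and> row (k + 10) y' = three_cycle a u (k + 10) (row u y)"
      using square_row_three_cycle[OF k, of y t] by (auto simp: n_def row_def u_def a_def)
  qed (auto simp: n_def)
  have labels: "row (k + 10) u \<in> {..<n}" "row (k + 11) u \<in> {..<n}"
    by (rule row_mem[OF _ u], simp add: n_def)+
  have cycle: "three_cycle a u (k + 10) \<in> mult_perms"
    using M.comp_mem[OF action_mem(1) action_mem(1), OF labels] product by simp
  have nonassoc: "\<not> associative_on {..<n} op"
  proof (rule not_associativeI[OF labels])
    have prod: "op (row (k + 10) u) (op (row (k + 11) u) z) = three_cycle a u (k + 10) z"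
      if "z < n" for z
      using fun_cong[OF product, of z] that closed[OF labels(2), of z] by (simp add: left_action_def)
    show "2 \<in> {..<n}" "op (row (k + 10) u) (op (row (k + 11) u) 2) = 2"
      using prod[of 2] a(1) by (auto simp: three_cycle_apply n_def a_def u_def)
    show "u \<in> {..<n}" "op (row (k + 10) u) (op (row (k + 11) u) u) \<noteq> u"
      using prod[of u] a(1) u by (auto simp: three_cycle_apply)
  qed
  have parity: "evenperm (left_action {..<n} op (row x u)) \<longleftrightarrow> (evenperm (row x) \<longleftrightarrow> evenperm (row u))"
    if "x < n" for x
  proof -
    have "permutation (row x)" "permutation (row u)"
      using row_permutes[of x] row_permutes[OF u] that permutation_permutes by blast+
    then show ?thesis
      using left_action_isotope[OF u u, of x] that
      by (simp add: op_def evenperm_comp evenperm_inv permutation_inverse)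
  qed
  have row_even: "evenperm (row x) \<longleftrightarrow> x < k + 9 \<or> t = evenperm (dbl (k + 9))" if "x < n" for x
    using evenperm_square_row[OF odd refl, of x t] that by (auto simp: row_def n_def add.commute)
  have right: "right_action {..<n} op p = left_action {..<n} op p" if "p \<in> {..<n}" for p
    using comm that by (auto simp: right_action_def left_action_def commutative_on_def)
  have "multiplication_group {..<n} op =
      (if t = evenperm (dbl (k + 9)) then alternating_group {..<n} else symmetric_group {..<n})"
  proof (cases "t = evenperm (dbl (k + 9))")
    case True
    have "evenperm (left_action {..<n} op p)" if p: "p \<in> {..<n}" for p
    proof -
      obtain x where "x \<in> {..<n}" "p = row x u" using col_label[OF u p] by blast
      then show ?thesis using parity row_even True u by simp
    qed
    then show ?thesis
      using three_cycle_even_imp_alternating[OF cycle a] right True by simp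
  next
    case False
    have "row 0 u \<in> {..<n}" by (rule row_mem[OF _ u]) (simp add: n_def)
    moreover have "\<not> evenperm (left_action {..<n} op (row 0 u))"
      using parity[of 0] row_even[of 0] row_even[of u] False u by (simp add: n_def u_def)
    ultimately show ?thesis
      using three_cycle_odd_imp_symmetric[OF cycle a action_mem(1)] False by simp
  qed
  then show thesis
    using that[OF unbreakable_loop_axioms comm nonassoc] by blast
qed

section \<open>The even family\<close>

text \<open>
  The addition table of the odd modulus \<open>m\<close> with three points at infinity.  For \<open>i = 0, 1, 2\<close> the entries at
  \<open>(x, x + 2 i)\<close> form a transversal; they are replaced by \<open>m + i\<close>, and the sums \<open>2 x + 2 i\<close> move to the column and
  the row \<open>m + i\<close>.  In the corner at infinity, distinct points have the third one as
  entry, and equal points themselves.  Without further change the points at infinity would be a subsquare, hence a subloop of the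
  isotope.  To break it, the entry \<open>0\<close> stays at \<open>(0, 0)\<close>, the point \<open>m\<close> goes to \<open>(0, m)\<close> and \<open>(m, 0)\<close>, and \<open>(m, m)\<close>
  receives \<open>0\<close>.
\<close>

definition wide_row :: "nat \<Rightarrow> nat \<Rightarrow> nat \<Rightarrow> nat"
  where "wide_row m x =
    (if x = m then dbl m \<circ> apply_transps [(0, m), (m + 1, m + 2)]
     else if x = m + 1 then rot m (m - 2) \<circ> dbl m \<circ> transpose m (m + 2)
     else if x = m + 2 then rot m (m - 4) \<circ> dbl m \<circ> transpose m (m + 1)
     else rot m x \<circ> apply_transps
       ((if x = 0 then [] else [(x, m)]) @ [((x + 2) mod m, m + 1), ((x + 4) mod m, m + 2)]))"

definition wide_col :: "nat \<Rightarrow> nat \<Rightarrow> nat \<Rightarrow> nat"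
  where "wide_col m y =
    (if y = m then dbl m \<circ> apply_transps [(0, m), (m + 1, m + 2)]
     else if y = m + 1 then rot m 2 \<circ> dbl m \<circ> transpose m (m + 2)
     else if y = m + 2 then rot m 4 \<circ> dbl m \<circ> transpose m (m + 1)
     else rot m y \<circ> apply_transps
       ((if y = 0 then [] else [(y, m)]) @ [((y + (m - 2)) mod m, m + 1), ((y + (m - 4)) mod m, m + 2)]))"

lemma wide_permutes:
  assumes "odd m" "5 \<le> m" "x < m + 3"
  shows "wide_row m x permutes {..<m + 3}" "wide_col m x permutes {..<m + 3}"
proof -
  have m: "z mod m < m + 3" for z
    using assms(2) mod_less_divisor[of m z] by linarith
  have either: "(if c then f else g) permutes {..<m + 3}"
    if "f permutes {..<m + 3}" "g permutes {..<m + 3}" for c and f g :: "nat \<Rightarrow> nat"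
    using that by simp
  have rot: "rot m i permutes {..<m + 3}" for i
    by (rule rot_permutes) simp
  have dbl: "dbl m permutes {..<m + 3}"
    using assms(1) by (intro dbl_permutes) auto
  have fixed: "apply_transps [(0, m), (m + 1, m + 2)] permutes {..<m + 3}"
    by (rule permutes_apply_transps) simp
  have bulk: "apply_transps ((if x = 0 then [] else [(x, m)]) @
    [((x + i) mod m, m + 1), ((x + j) mod m, m + 2)]) permutes {..<m + 3}" for i j
    using assms m by (intro permutes_apply_transps) auto
  have swap: "transpose m (m + 1) permutes {..<m + 3}" "transpose m (m + 2) permutes {..<m + 3}"
    by (auto intro: permutes_swap_id)
  show "wide_row m x permutes {..<m + 3}" "wide_col m x permutes {..<m + 3}"
    unfolding wide_row_def wide_col_def by (intro either permutes_compose rot dbl fixed bulk swap)+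
qed

lemma mod_shift:
  fixes m x :: nat
  shows "x < m \<Longrightarrow> i \<le> m \<Longrightarrow> (x + i) mod m = (if x + i < m then x + i else x + i - m)"
  by (auto simp: mod_if)

lemma mod_shift_eq_iff:
  fixes m x y i :: nat
  assumes "x < m" "y < m" "i \<le> m"
  shows "y = (x + i) mod m \<longleftrightarrow> x = (y + (m - i)) mod m"
  using assms mod_shift[of x m i] mod_shift[of y m "m - i"] by auto

lemma mod_shift_cancel:
  fixes m x i j :: nat
  assumes "i < m" "j < m"
  shows "(x + i) mod m = (x + j) mod m \<longleftrightarrow> i = j"
proof -
  have "x mod m < m" using assms by simp
  moreover have "(x + l) mod m = (x mod m + l) mod m" for l by (simp add: mod_simps)
  ultimately show ?thesis
    using assms mod_shift[of "x mod m" m i] mod_shift[of "x mod m" m j] by auto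
qed

lemma shifts_distinct:
  fixes m x i j :: nat
  assumes "x < m" "0 < i" "0 < j" "i < m" "j < m" "i \<noteq> j"
  shows "(x + i) mod m \<noteq> x" "(x + j) mod m \<noteq> x" "(x + i) mod m \<noteq> (x + j) mod m"
    "(x + i) mod m < m" "(x + j) mod m < m"
  using assms mod_shift_cancel[of i m 0 x] mod_shift_cancel[of j m 0 x] mod_shift_cancel[of i m j x]
  by auto

lemma rot_transps:
  fixes m x y a b :: nat
  assumes "x < m" "y < m" "a < m" "b < m" "a \<noteq> x" "b \<noteq> x" "a \<noteq> b"
  shows "rot m x (apply_transps ((if x = 0 then [] else [(x, m)]) @ [(a, m + 1), (b, m + 2)]) y) =
    (if y = x \<and> x \<noteq> 0 then m else if y = a then m + 1 else if y = b then m + 2 else (x + y) mod m)"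
proof -
  consider "y = x" | "y = a" | "y = b" | "y \<noteq> x" "y \<noteq> a" "y \<noteq> b" by blast
  then show ?thesis
    using assms by cases (simp_all add: transpose_def rot_def add.commute)
qed

lemma rot_transps_infinity:
  fixes m x a b :: nat
  assumes "x < m" "a < m" "b < m" "a \<noteq> x" "b \<noteq> x" "a \<noteq> b"
  defines "sw \<equiv> (if x = 0 then [] else [(x, m)]) @ [(a, m + 1), (b, m + 2)]"
  shows "rot m x (apply_transps sw m) = (if x = 0 then m else (x + x) mod m)"
    and "rot m x (apply_transps sw (m + 1)) = (a + x) mod m"
    and "rot m x (apply_transps sw (m + 2)) = (b + x) mod m"
  using assms by (simp_all add: sw_def transpose_def rot_def)

lemma wide_row_bulk:
  assumes "5 \<le> m" "x < m" "y < m"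
  shows "wide_row m x y =
    (if y = x \<and> x \<noteq> 0 then m else if y = (x + 2) mod m then m + 1
     else if y = (x + 4) mod m then m + 2 else (x + y) mod m)"
proof -
  have "x \<noteq> m" "x \<noteq> m + 1" "x \<noteq> m + 2" using assms by simp_all
  then have "wide_row m x y = rot m x (apply_transps
      ((if x = 0 then [] else [(x, m)]) @ [((x + 2) mod m, m + 1), ((x + 4) mod m, m + 2)]) y)"
    by (simp only: wide_row_def if_False comp_apply)
  also note rot_transps
  finally show ?thesis
    using assms shifts_distinct[of x m 2 4] by simp
qed

lemma wide_col_bulk:
  assumes "5 \<le> m" "x < m" "y < m"
  shows "wide_col m x y =
    (if y = x \<and> x \<noteq> 0 then m else if y = (x + (m - 2)) mod m then m + 1
     else if y = (x + (m - 4)) mod m then m + 2 else (x + y) mod m)"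
proof -
  have "x \<noteq> m" "x \<noteq> m + 1" "x \<noteq> m + 2" using assms by simp_all
  then have "wide_col m x y = rot m x (apply_transps
      ((if x = 0 then [] else [(x, m)]) @ [((x + (m - 2)) mod m, m + 1), ((x + (m - 4)) mod m, m + 2)]) y)"
    by (simp only: wide_col_def if_False comp_apply)
  also note rot_transps
  finally show ?thesis
    using assms shifts_distinct[of x m "m - 2" "m - 4"] by simp
qed

lemma wide_infinity:
  assumes "5 \<le> m" "x < m"
  shows "wide_row m x m = (if x = 0 then m else (2 * x) mod m)"
    and "wide_row m x (m + 1) = (2 * x + 2) mod m"
    and "wide_row m x (m + 2) = (2 * x + 4) mod m"
    and "wide_row m m x = (if x = 0 then m else (2 * x) mod m)"
    and "wide_row m (m + 1) x = (2 * x + (m - 2)) mod m"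
    and "wide_row m (m + 2) x = (2 * x + (m - 4)) mod m"
    and "wide_col m x m = (if x = 0 then m else (2 * x) mod m)"
    and "wide_col m x (m + 1) = (2 * x + (m - 2)) mod m"
    and "wide_col m x (m + 2) = (2 * x + (m - 4)) mod m"
    and "wide_col m m x = (if x = 0 then m else (2 * x) mod m)"
    and "wide_col m (m + 1) x = (2 * x + 2) mod m"
    and "wide_col m (m + 2) x = (2 * x + 4) mod m"
proof -
  have "0 < m - 2" "0 < m - 4" "m - 2 < m" "m - 4 < m" "m - 2 \<noteq> m - 4"
    using assms(1) by auto
  note bwd = shifts_distinct[OF assms(2) this]
  have "0 < (2::nat)" "0 < (4::nat)" "2 < m" "4 < m" "2 \<noteq> (4::nat)"
    using assms(1) by auto
  note fwd = shifts_distinct[OF assms(2) this]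
  have x: "x \<noteq> m" "x \<noteq> m + 1" "x \<noteq> m + 2" using assms by simp_all
  have sum: "((x + i) mod m + x) mod m = (2 * x + i) mod m" for i
  proof -
    have "((x + i) mod m + x) mod m = (x + i + x) mod m" by (rule mod_add_left_eq)
    also have "x + i + x = 2 * x + i" by simp
    finally show ?thesis .
  qed
  note row = rot_transps_infinity[OF assms(2) fwd(4,5,1,2,3)]
  note col = rot_transps_infinity[OF assms(2) bwd(4,5,1,2,3)]
  show "wide_row m x m = (if x = 0 then m else (2 * x) mod m)"
    "wide_row m x (m + 1) = (2 * x + 2) mod m" "wide_row m x (m + 2) = (2 * x + 4) mod m"
    by (simp_all only: wide_row_def x if_False comp_apply row sum mult_2)
  show "wide_col m x m = (if x = 0 then m else (2 * x) mod m)"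
    "wide_col m x (m + 1) = (2 * x + (m - 2)) mod m" "wide_col m x (m + 2) = (2 * x + (m - 4)) mod m"
    by (simp_all only: wide_col_def x if_False comp_apply col sum mult_2)
  have "transpose m (m + 1) x = x" "transpose m (m + 2) x = x"
    using assms(2) by (simp_all add: transpose_def)
  moreover have "rot m i (dbl m x) = (2 * x + i) mod m" for i
    using assms(2) by (simp add: rot_def dbl_def mod_add_left_eq)
  ultimately show "wide_row m (m + 1) x = (2 * x + (m - 2)) mod m"
    "wide_row m (m + 2) x = (2 * x + (m - 4)) mod m"
    "wide_col m (m + 1) x = (2 * x + 2) mod m" "wide_col m (m + 2) x = (2 * x + 4) mod m"
    by (simp_all only: wide_row_def wide_col_def comp_apply) simp_all
  show "wide_row m m x = (if x = 0 then m else (2 * x) mod m)"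
    "wide_col m m x = (if x = 0 then m else (2 * x) mod m)"
    using assms(2) by (simp_all add: wide_row_def wide_col_def transpose_def dbl_def)
qed

lemma wide_row_col:
  assumes m: "5 \<le> m" and "x < m + 3" "y < m + 3"
  shows "wide_row m x y = wide_col m y x"
proof -
  consider "x < m" "y < m" | "x < m" "m \<le> y" | "m \<le> x" "y < m" | "m \<le> x" "m \<le> y"
    by linarith
  then show ?thesis
  proof cases
    case 1
    have diag: "y = x \<and> x \<noteq> 0 \<longleftrightarrow> x = y \<and> y \<noteq> 0" by blast
    have off: "y = (x + 2) mod m \<longleftrightarrow> x = (y + (m - 2)) mod m" "y = (x + 4) mod m \<longleftrightarrow> x = (y + (m - 4)) mod m"
      by (rule mod_shift_eq_iff; use 1 m in simp)+
    show ?thesis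
      unfolding wide_row_bulk[OF m 1] wide_col_bulk[OF m 1(2,1)] diag off add.commute[of x y] ..
  next
    case 2
    then have "y \<in> {m, m + 1, m + 2}" using assms by auto
    then show ?thesis
      using 2 m by (elim insertE emptyE) (simp_all only: wide_infinity)
  next
    case 3
    then have "x \<in> {m, m + 1, m + 2}" using assms by auto
    then show ?thesis
      using 3 m by (elim insertE emptyE) (simp_all only: wide_infinity)
  next
    case 4
    then have "x \<in> {m, m + 1, m + 2}" "y \<in> {m, m + 1, m + 2}" using assms by auto
    then show ?thesis
      using m by (elim insertE emptyE) (simp_all add: wide_row_def wide_col_def transpose_def rot_def dbl_def)
  qed
qed

text \<open>
  With row \<open>u = m + 1\<close> and column \<open>v = m\<close>, the label \<open>z = 2 x\<close> belongs to row \<open>x\<close> and to column \<open>x + 1\<close>, whose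
  entry is \<open>2 x + 1\<close>: squaring raises a residue by one.  A nontrivial subloop contains the identity and
  all residues but possibly \<open>1\<close>, more than half of the loop.

  The three rows at infinity are affine with equally spaced constants, so the quotients of the rows \<open>m\<close>
  and \<open>m + 2\<close> by row \<open>m + 1\<close> would be inverse to each other without the change at \<open>0\<close>.  With it, their
  product is the transposition of \<open>0\<close> and \<open>m\<close>.
\<close>

theorem even_loop_exists:
  fixes m :: nat
  assumes m: "odd m" "5 \<le> m"
  defines "n \<equiv> m + 3"
  obtains op where "unbreakable_loop {..<n} op" "\<not> associative_on {..<n} op"
    "multiplication_group {..<n} op = symmetric_group {..<n}"
proof -
  interpret latin_square "{..<n}" "wide_row m" "wide_col m"
    by standard (use wide_permutes[OF m] wide_row_col[OF m(2)] in \<open>auto simp: n_def\<close>)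
  define u where "u = m + 1"
  define v where "v = m"
  have u: "u \<in> {..<n}" and v: "v \<in> {..<n}" by (simp_all add: u_def v_def n_def)
  define op where "op = isotope u v"
  define e where "e = wide_row m u v"
  interpret loop "{..<n}" op
    unfolding op_def using u v by (rule loop_isotope)
  note op_row = isotope_row_row[OF u v, folded op_def]
  have e_eq: "e = m + 2"
    using m(2) by (simp add: e_def u_def v_def wide_row_def transpose_def rot_def dbl_def)
  have e: "e \<in> {..<n}" "\<And>x. x \<in> {..<n} \<Longrightarrow> op e x = x"
    using row_mem[OF u v] isotope_identity[OF u v] by (simp_all add: e_def op_def)
  have row_eval: "wide_row m 0 v = m" "wide_row m m v = 0" "wide_row m (m + 2) v = m + 1"
    "wide_row m u (m + 2) = m" "wide_row m u (m + 1) = m + 1" "wide_row m u 1 = 0"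
    "wide_row m m 1 = 2" "wide_row m 0 (m + 2) = 4" "wide_row m (m + 2) (m + 1) = m"
    "wide_row m m (m + 1) = m + 2" "wide_row m u m = m + 2" "wide_row m (m + 2) (m + 2) = m + 2"
    using m(2) le_add_diff_inverse[of 2 m]
    by (simp_all add: u_def v_def wide_row_def transpose_def rot_def dbl_def)
  have row_eval_one: "wide_row m (m + 2) 1 = m - 2" "wide_row m u 0 = m - 2" "wide_row m m 0 = m"
    using m(2) wide_infinity(6)[OF m(2), of 1] wide_infinity(5)[OF m(2), of 0] wide_infinity(4)[OF m(2), of 0]
    by (simp_all add: u_def)
  have squares: "op (m + 1) (m + 1) = m" "op m m = 4" "op 0 0 = 2"
    using op_row[of "m + 2" "m + 1", unfolded row_eval] op_row[of 0 "m + 2", unfolded row_eval]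
      op_row[of m 1, unfolded row_eval] m(2)
    by (simp_all add: n_def)
  have succ: "op z z = (z + 1) mod m" if z: "0 < z" "z < m" for z
  proof -
    obtain x where x: "2 * x = z \<or> 2 * x = z + m"
      using m(1) by (metis dvd_def odd_even_add)
    then have range: "0 < x" "x < m" using z by auto
    have double: "(2 * x) mod m = z" using x z by auto
    have "wide_row m x v = z"
      using wide_infinity(1)[OF m(2) range(2)] range double by (simp add: v_def)
    moreover have "wide_row m u ((x + 1) mod m) = z"
    proof -
      have "wide_row m u ((x + 1) mod m) = (2 * ((x + 1) mod m) + (m - 2)) mod m"
        using wide_infinity(5)[OF m(2), of "(x + 1) mod m"] m(2) by (simp add: u_def)
      also have "\<dots> = (2 * (x + 1) + (m - 2)) mod m" by (metis mod_add_left_eq mod_mult_right_eq)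
      also have "2 * (x + 1) + (m - 2) = 2 * x + m" using m(2) by simp
      finally show ?thesis using double by simp
    qed
    moreover have "wide_row m x ((x + 1) mod m) = (z + 1) mod m"
    proof -
      have "(x + 1) mod m \<noteq> x" "(x + 1) mod m \<noteq> (x + 2) mod m" "(x + 1) mod m \<noteq> (x + 4) mod m"
        using m(2) range(2) mod_shift_cancel[of 1 m 0 x] mod_shift_cancel[of 1 m 2 x]
          mod_shift_cancel[of 1 m 4 x] by auto
      then have "wide_row m x ((x + 1) mod m) = (x + (x + 1) mod m) mod m"
        using m(2) range(2) by (simp add: wide_row_bulk)
      also have "\<dots> = (2 * x + 1) mod m" by (simp add: mod_add_right_eq mult_2)
      also have "\<dots> = (z + 1) mod m" using double by (metis mod_add_left_eq)
      finally show ?thesis .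
    qed
    moreover have "(x + 1) mod m < m + 3"
      using m(2) mod_less_divisor[of m "x + 1"] by linarith
    ultimately show ?thesis
      using op_row[of x "(x + 1) mod m"] range(2) by (simp add: n_def)
  qed
  interpret unbreakable_loop "{..<n}" op
  proof (rule unbreakable_loopI[OF _ e])
    fix H z assume H: "e \<in> H" "z \<in> H" "z \<noteq> e" "H \<subseteq> {..<n}"
      and closed: "\<And>x y. x \<in> H \<Longrightarrow> y \<in> H \<Longrightarrow> op x y \<in> H"
    have up: "y \<in> H" if "x \<in> H" "0 < x" "x \<le> y" "y < m" for x y
      using that(3,4)
    proof (induction rule: dec_induct)
      case (step k)
      then have "k \<in> H" by simp
      then show ?case using closed[of k k] succ[of k] step that by simp
    qed (use that in simp)
    have zero: "0 \<in> H" if "x \<in> H" "0 < x" "x < m" for x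
    proof -
      have "m - 1 \<in> H" using up[OF that(1,2), of "m - 1"] that(3) by simp
      then show ?thesis using closed[of "m - 1" "m - 1"] succ[of "m - 1"] m(2) by simp
    qed
    have "0 \<in> H"
    proof -
      have "z < n" using H(2,4) by blast
      then consider "z = 0" | "0 < z" "z < m" | "z = m" | "z = m + 1"
        using H(3) unfolding n_def e_eq by linarith
      then show ?thesis
      proof cases
        case 3
        then have "4 \<in> H" using closed[OF H(2,2)] squares by simp
        then show ?thesis using zero[of 4] m(2) by simp
      next
        case 4
        then have "m \<in> H" using closed[OF H(2,2)] squares by simp
        then have "4 \<in> H" using closed[of m m] squares by simp
        then show ?thesis using zero[of 4] m(2) by simp
      qed (use H(2) zero in auto)
    qed
    then have "2 \<in> H" using closed[of 0 0] squares by simp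
    then have "{2..<m} \<subseteq> H" using up[of 2] by auto
    then have "insert 0 (insert (m + 2) {2..<m}) \<subseteq> H" using \<open>0 \<in> H\<close> H(1) e_eq by simp
    then have "card (insert 0 (insert (m + 2) {2..<m})) \<le> card H"
      using H(4) by (intro card_mono) (auto intro: finite_subset)
    moreover have "card (insert 0 (insert (m + 2) {2..<m})) = m"
      using m(2) by simp
    ultimately show "card {..<n} < 2 * card H" using m(2) by (simp add: n_def)
  qed simp_all
  have product: "left_action {..<n} op (wide_row m m v) \<circ> left_action {..<n} op (wide_row m (m + 2) v)
      = transpose 0 m"
    unfolding op_def
  proof (rule left_actions_compose[OF u v])
    show "transpose 0 m permutes {..<n}" by (rule permutes_swap_id) (auto simp: n_def)
    fix y assume "y \<in> {..<n}"
    then have "y = 1 \<or> y < m \<and> y \<noteq> 1 \<or> y = m \<or> y = m + 1 \<or> y = m + 2"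
      unfolding n_def lessThan_iff by presburger
    then consider "y = 1" | "y < m" "y \<noteq> 1" | "y = m" | "y = m + 1" | "y = m + 2"
      by blast
    then show "\<exists>y'\<in>{..<n}. wide_row m (m + 2) y = wide_row m u y' \<and>
      wide_row m m y' = transpose 0 m (wide_row m u y)"
    proof cases
      case 1
      have "wide_row m (m + 2) y = wide_row m u 0 \<and> wide_row m m 0 = transpose 0 m (wide_row m u y)"
        unfolding 1 row_eval row_eval_one by simp
      moreover have "0 \<in> {..<n}" by (simp add: n_def)
      ultimately show ?thesis by blast
    next
      case 2
      let ?y = "(y + (m - 1)) mod m"
      have y': "?y < m" "?y \<noteq> 0"
        using 2 m(2) by (auto simp: mod_if)
      have "wide_row m u ?y = (2 * ?y + (m - 2)) mod m"
        using wide_infinity(5)[OF m(2) y'(1)] by (simp add: u_def)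
      also have "\<dots> = (2 * (y + (m - 1)) + (m - 2)) mod m"
        by (metis mod_add_left_eq mod_mult_right_eq)
      also have "2 * (y + (m - 1)) + (m - 2) = 2 * y + (m - 4) + 2 * m"
        using m(2) by simp
      finally have fst_step: "wide_row m u ?y = wide_row m (m + 2) y"
        using wide_infinity(6)[OF m(2) 2(1)] by simp
      have snd_step: "wide_row m m ?y = wide_row m u y"
      proof -
        have "wide_row m m ?y = (2 * ?y) mod m"
          using wide_infinity(4)[OF m(2) y'(1)] y'(2) by simp
        also have "\<dots> = (2 * (y + (m - 1))) mod m" by (rule mod_mult_right_eq)
        also have "2 * (y + (m - 1)) = 2 * y + (m - 2) + m" using m(2) by simp
        finally show ?thesis
          using wide_infinity(5)[OF m(2) 2(1)] by (simp add: u_def)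
      qed
      have unmoved: "wide_row m m ?y \<noteq> 0" "wide_row m m ?y \<noteq> m"
      proof -
        obtain z where z: "z = ?y" by blast
        have "wide_row m m ?y = (2 * z) mod m"
          unfolding z using wide_infinity(4)[OF m(2) y'(1)] y'(2) by simp
        moreover have range: "0 < z" "z < m" using y' unfolding z by simp_all
        moreover have "(2 * z) mod m = (if 2 * z < m then 2 * z else 2 * z - m)"
          using mod_shift[of z m z] range(2) by (simp add: mult_2)
        ultimately have double: "wide_row m m ?y = 2 * z \<and> 2 * z < m \<or> wide_row m m ?y + m = 2 * z"
          by auto
        have parity: "w \<noteq> 0 \<and> w \<noteq> m" if "w = 2 * z \<and> 2 * z < m \<or> w + m = 2 * z" for w
        proof (cases "w = 2 * z \<and> 2 * z < m")
          case False
          then have sum: "w + m = 2 * z" using that by blast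
          then have "odd w" using m(1) by (metis dvd_triv_left even_add)
          then have "w \<noteq> 0" by (rule contrapos_nn) simp
          moreover have "w \<noteq> m" using sum range(2) by linarith
          ultimately show ?thesis ..
        qed (use range in linarith)
        show "wide_row m m ?y \<noteq> 0" "wide_row m m ?y \<noteq> m"
          by (rule conjunct1[OF parity[OF double]], rule conjunct2[OF parity[OF double]])
      qed
      have "wide_row m (m + 2) y = wide_row m u ?y \<and> wide_row m m ?y = transpose 0 m (wide_row m u y)"
        unfolding fst_step snd_step[symmetric] transpose_apply_other[OF unmoved] by blast
      moreover have "?y \<in> {..<n}" using y'(1) unfolding n_def lessThan_iff by linarith
      ultimately show ?thesis by blast
    next
      case 3
      have "wide_row m (m + 2) y = wide_row m u (m + 1) \<and> wide_row m m (m + 1) = transpose 0 m (wide_row m u y)"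
        unfolding 3 row_eval row_eval(3)[unfolded v_def] by simp
      moreover have "m + 1 \<in> {..<n}" by (simp add: n_def)
      ultimately show ?thesis by blast
    next
      case 4
      have "wide_row m m (m + 2) = m + 1" by (simp add: wide_row_def transpose_def dbl_def)
      then have "wide_row m (m + 2) y = wide_row m u (m + 2) \<and> wide_row m m (m + 2) = transpose 0 m (wide_row m u y)"
        unfolding 4 row_eval by simp
      moreover have "m + 2 \<in> {..<n}" by (simp add: n_def)
      ultimately show ?thesis by blast
    next
      case 5
      have "wide_row m (m + 2) y = wide_row m u m \<and> wide_row m m m = transpose 0 m (wide_row m u y)"
        unfolding 5 row_eval row_eval(2)[unfolded v_def] by simp
      moreover have "m \<in> {..<n}" by (simp add: n_def)
      ultimately show ?thesis by blast
    qed
  qed (simp_all add: n_def)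
  have labels: "wide_row m m v \<in> {..<n}" "wide_row m (m + 2) v \<in> {..<n}"
    by (rule row_mem[OF _ v], simp add: n_def)+
  have "transpose 0 m \<in> mult_perms"
    using M.comp_mem[OF action_mem(1) action_mem(1), OF labels] product by simp
  then have group: "multiplication_group {..<n} op = symmetric_group {..<n}"
    by (rule transposition_imp_symmetric) (use m in \<open>auto simp: n_def\<close>)
  have "\<not> associative_on {..<n} op"
  proof (rule not_associativeI[OF labels])
    have prod: "op (wide_row m m v) (op (wide_row m (m + 2) v) z) = transpose 0 m z" if "z < n" for z
      using fun_cong[OF product, of z] that closed[OF labels(2), of z] by (simp add: left_action_def)
    show "1 \<in> {..<n}" "op (wide_row m m v) (op (wide_row m (m + 2) v) 1) = 1"
      using prod[of 1] m(2) by (auto simp: n_def transpose_def)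
    show "0 \<in> {..<n}" "op (wide_row m m v) (op (wide_row m (m + 2) v) 0) \<noteq> 0"
      using prod[of 0] m(2) by (auto simp: n_def)
  qed
  then show thesis
    using that[OF unbreakable_loop_axioms _ group] by blast
qed

section \<open>Multiplication tables of small order\<close>

text \<open>
  Row \<open>a\<close> of a table lists the products of \<open>a\<close> with \<open>0, 1, \<dots>\<close>, and \<open>0\<close> is the identity.
\<close>

definition loop_table :: "nat list list \<Rightarrow> bool"
  where "loop_table T \<longleftrightarrow> (let n = length T in
    0 < n \<and> list_all (\<lambda>r. length r = n \<and> distinct r \<and> list_all (\<lambda>k. k < n) r) T \<and>
    list_all (\<lambda>b. distinct (map (\<lambda>r. r ! b) T)) [0..<n] \<and>
    T ! 0 = [0..<n] \<and> map (\<lambda>r. r ! 0) T = [0..<n])"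

text \<open>
  A criterion for being unbreakable that is easily evaluated: the identity, an element \<open>a\<close> and its first
  four iterated squares together make up more than half of the loop.
\<close>

definition large_square_orbits :: "nat list list \<Rightarrow> bool"
  where "large_square_orbits T \<longleftrightarrow>
    list_all (\<lambda>a. length T < 2 * length (remdups (0 # map (\<lambda>i. ((\<lambda>x. T ! x ! x) ^^ i) a) [0..<5])))
      [1..<length T]"

text \<open>
  The parity of a row is found by sorting it with exchanges, from the last position downwards.
\<close>

fun row_transps :: "nat \<Rightarrow> nat list \<Rightarrow> (nat \<times> nat) list"
  where "row_transps 0 r = []"
  | "row_transps (Suc i) r =
      (if r ! i = i then row_transps i r
       else (i, r ! i) # row_transps i (map (transpose i (r ! i)) r))"

lemma row_transps:
  assumes "distinct r" "set r \<subseteq> {..<length r}" "i \<le> length r"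
    and "\<And>j. i \<le> j \<Longrightarrow> j < length r \<Longrightarrow> r ! j = j"
  shows "(\<forall>(a, b)\<in>set (row_transps i r). a < length r \<and> b < length r \<and> a \<noteq> b) \<and>
    (\<forall>b<length r. apply_transps (row_transps i r) b = r ! b)"
  using assms
proof (induction i arbitrary: r)
  case (Suc i)
  show ?case
  proof (cases "r ! i = i")
    case True
    then have "r ! j = j" if "i \<le> j" "j < length r" for j
      using Suc.prems(4)[of j] that by (cases "j = i") auto
    then show ?thesis using Suc.IH[of r] Suc.prems True by simp
  next
    case False
    let ?t = "transpose i (r ! i)"
    let ?r = "map ?t r"
    have "i < length r" using Suc.prems(3) by simp
    moreover have "r ! i < length r"
      using nth_mem[OF calculation] Suc.prems(2) by blast
    ultimately have i: "i < length r" "r ! i < length r" .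
    have fixed: "?r ! j = j" if "i \<le> j" "j < length ?r" for j
    proof (cases "j = i")
      case False
      then have "r ! j = j" using Suc.prems(4)[of j] that by simp
      moreover have "r ! i \<noteq> j"
        using calculation False i that nth_eq_iff_index_eq[OF Suc.prems(1), of i j] by auto
      ultimately show ?thesis using False that by simp
    qed (use i in simp)
    have "distinct ?r" using Suc.prems(1) by (simp add: distinct_map)
    moreover have "set ?r \<subseteq> {..<length ?r}"
      using Suc.prems(2) i by (auto simp: transpose_def)
    ultimately have IH: "\<forall>(a, b)\<in>set (row_transps i ?r). a < length r \<and> b < length r \<and> a \<noteq> b"
      "\<forall>b<length r. apply_transps (row_transps i ?r) b = ?r ! b"
      using Suc.IH[of ?r] fixed i by simp_all
    then show ?thesis using False i by auto
  qed
qed simp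

definition row_parity :: "nat list \<Rightarrow> bool"
  where "row_parity r = even (length (row_transps (length r) r))"

definition table_product :: "nat list list \<Rightarrow> nat \<Rightarrow> nat \<Rightarrow> nat list"
  where "table_product T p q = map (\<lambda>b. T ! p ! (T ! q ! b)) [0..<length T]"

definition table_op :: "nat list list \<Rightarrow> nat \<Rightarrow> nat \<Rightarrow> nat"
  where "table_op T a b = T ! a ! b"

lemma loop_table_op:
  assumes "loop_table T" "n = length T"
  shows "loop {..<n} (table_op T)" and "0 < n" "\<And>a. a < n \<Longrightarrow> table_op T 0 a = a"
proof -
  have n: "0 < n" and rows: "\<forall>r\<in>set T. length r = n \<and> distinct r \<and> (\<forall>k\<in>set r. k < n)"
    and col: "\<And>b. b < n \<Longrightarrow> distinct (map (\<lambda>r. r ! b) T)"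
    and ident: "T ! 0 = [0..<n]" "map (\<lambda>r. r ! 0) T = [0..<n]"
    using assms by (simp_all add: loop_table_def Let_def list_all_iff)
  have row: "length (T ! a) = n \<and> distinct (T ! a) \<and> (\<forall>k\<in>set (T ! a). k < n)" if "a < n" for a
    using rows nth_mem[of a T] that assms(2) by blast
  have ident': "table_op T a 0 = a" if "a < n" for a
    using arg_cong[OF ident(2), of "\<lambda>l. l ! a"] that assms(2) by (simp add: table_op_def)
  show zero: "table_op T 0 a = a" if "a < n" for a
    using that by (simp add: table_op_def ident(1))
  have "quasigroup {..<n} (table_op T)"
  proof (rule quasigroupI)
    show "table_op T a b \<in> {..<n}" if "a \<in> {..<n}" "b \<in> {..<n}" for a b
      using row[of a] that by (simp add: table_op_def)
    show "inj_on (table_op T a) {..<n}" if "a \<in> {..<n}" for a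
      using row[of a] that by (auto simp: table_op_def inj_on_def nth_eq_iff_index_eq)
    show "inj_on (\<lambda>a. table_op T a b) {..<n}" if "b \<in> {..<n}" for b
    proof (rule inj_onI)
      fix a c assume ac: "a \<in> {..<n}" "c \<in> {..<n}" "table_op T a b = table_op T c b"
      then have "map (\<lambda>r. r ! b) T ! a = map (\<lambda>r. r ! b) T ! c"
        using assms(2) by (simp add: table_op_def)
      then show "a = c"
        using col[of b] ac that assms(2) by (simp only: nth_eq_iff_index_eq length_map lessThan_iff)
    qed
  qed simp
  then show "loop {..<n} (table_op T)"
    using n zero ident' by (intro loop.intro loop_axioms.intro) (auto intro!: bexI[of _ 0])
qed (use assms in \<open>auto simp: loop_table_def Let_def\<close>)

lemma unbreakable_table:
  assumes T: "loop_table T" "n = length T" and large: "large_square_orbits T"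
  shows "unbreakable_loop {..<n} (table_op T)"
proof -
  interpret loop "{..<n}" "table_op T" using T by (rule loop_table_op)
  show ?thesis
  proof (rule unbreakable_loopI[where e = 0])
    fix H a assume H: "0 \<in> H" "a \<in> H" "a \<noteq> 0" "H \<subseteq> {..<n}"
      and closed: "\<And>x y. x \<in> H \<Longrightarrow> y \<in> H \<Longrightarrow> table_op T x y \<in> H"
    let ?l = "0 # map (\<lambda>i. ((\<lambda>x. T ! x ! x) ^^ i) a) [0..<5]"
    have "((\<lambda>x. T ! x ! x) ^^ i) a \<in> H" for i
      by (induction i) (use H(2) closed in \<open>auto simp: table_op_def\<close>)
    then have "set ?l \<subseteq> H" using H(1) by auto
    then have "card (set ?l) \<le> card H"
      using H(4) by (intro card_mono) (auto intro: finite_subset)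
    moreover have "a \<in> {1..<n}" using H by auto
    then have "n < 2 * length (remdups ?l)"
      using large T(2) by (simp only: large_square_orbits_def list_all_iff set_upt)
    ultimately show "card {..<n} < 2 * card H"
      by (simp only: length_remdups_card_conv card_lessThan)
  qed (use loop_table_op[OF T] in auto)
qed

lemma row_parity:
  assumes T: "loop_table T" "n = length T" and "a < n"
  shows "evenperm (left_action {..<n} (table_op T) a) = row_parity (T ! a)"
proof -
  interpret loop "{..<n}" "table_op T" using T by (rule loop_table_op)
  have "T ! a \<in> set T" using T(2) \<open>a < n\<close> by simp
  then have r: "length (T ! a) = n" "distinct (T ! a)" "set (T ! a) \<subseteq> {..<length (T ! a)}"
    using T by (auto simp: loop_table_def Let_def list_all_iff)
  let ?xs = "row_transps (length (T ! a)) (T ! a)"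
  have xs: "\<forall>(a, b)\<in>set ?xs. a < n \<and> b < n \<and> a \<noteq> b" "\<forall>b<n. apply_transps ?xs b = T ! a ! b"
    using row_transps[OF r(2,3), of n] r(1) by simp_all
  have "apply_transps ?xs permutes {..<n}"
    using xs(1) by (intro permutes_apply_transps) auto
  then have "left_action {..<n} (table_op T) a = apply_transps ?xs"
    using xs(2) by (auto simp: fun_eq_iff left_action_def table_op_def permutes_not_in)
  moreover have "evenperm (apply_transps ?xs) \<longleftrightarrow> even (length ?xs)"
    using xs(1) by (intro evenperm_apply_transps_iff) auto
  ultimately show ?thesis by (simp add: row_parity_def)
qed

lemma table_three_cycle:
  assumes T: "loop_table T" "n = length T" and pq: "p < n" "q < n"
    and xyz: "distinct [x, y, z]" "x < n" "y < n" "z < n"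
    and product: "table_product T p q = map (three_cycle x y z) [0..<n]" and "3 < n"
  shows "three_cycle x y z \<in> loop.mult_perms {..<n} (table_op T)"
    and "\<not> associative_on {..<n} (table_op T)"
proof -
  interpret loop "{..<n}" "table_op T" using T by (rule loop_table_op)
  interpret M: permutation_group "{..<n}" mult_perms
    by (rule permutation_group_mult_perms) simp
  have prod: "table_op T p (table_op T q b) = three_cycle x y z b" if "b < n" for b
    using arg_cong[OF product, of "\<lambda>l. l ! b"] that T(2) by (simp add: table_product_def table_op_def)
  have "left_action {..<n} (table_op T) p \<circ> left_action {..<n} (table_op T) q = three_cycle x y z"
    using prod pq xyz closed[of q] by (auto simp: fun_eq_iff left_action_def three_cycle_apply)
  then show "three_cycle x y z \<in> mult_perms"
    using M.comp_mem[OF action_mem(1) action_mem(1), of p q] pq by simp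
  have "\<not> {..<n} \<subseteq> {x, y, z}"
    using \<open>3 < n\<close> card_mono[of "{x, y, z}" "{..<n}"] card_length[of "[x, y, z]"] by auto
  then obtain b where "b < n" "b \<notin> {x, y, z}" by blast
  then show "\<not> associative_on {..<n} (table_op T)"
    using prod[of b] prod[of x] xyz pq
    by (intro not_associativeI[of p q b x]) (auto simp: three_cycle_apply)
qed

lemma symmetric_table:
  assumes T: "loop_table T" "n = length T" and large: "large_square_orbits T"
    and pq: "p < n" "q < n" and xyz: "distinct [x, y, z]" "x < n" "y < n" "z < n"
    and product: "table_product T p q = map (three_cycle x y z) [0..<n]" and "3 < n"
    and odd: "a < n" "\<not> row_parity (T ! a)"
  shows "multiplication_group {..<n} (table_op T) = symmetric_group {..<n}"
proof -
  interpret unbreakable_loop "{..<n}" "table_op T"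
    using T large by (rule unbreakable_table)
  show ?thesis
    by (rule three_cycle_odd_imp_symmetric[OF table_three_cycle(1)[OF T pq xyz product \<open>3 < n\<close>]
          xyz(1) _ action_mem(1)[of a]])
      (use xyz odd row_parity[OF T odd(1)] in auto)
qed

lemma alternating_table:
  assumes T: "loop_table T" "n = length T" and large: "large_square_orbits T"
    and pq: "p < n" "q < n" and xyz: "distinct [x, y, z]" "x < n" "y < n" "z < n"
    and product: "table_product T p q = map (three_cycle x y z) [0..<n]" and "3 < n"
    and even: "list_all row_parity T"
    and comm: "commutative_on {..<n} (table_op T)"
  shows "multiplication_group {..<n} (table_op T) = alternating_group {..<n}"
proof -
  interpret unbreakable_loop "{..<n}" "table_op T"
    using T large by (rule unbreakable_table)
  have "evenperm (left_action {..<n} (table_op T) a)" if "a < n" for a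
    using row_parity[OF T that] even that T(2) by (auto simp: list_all_iff)
  moreover have "right_action {..<n} (table_op T) a = left_action {..<n} (table_op T) a" if "a < n" for a
    using comm that by (auto simp: right_action_def left_action_def commutative_on_def)
  ultimately show ?thesis
    using xyz by (intro three_cycle_even_imp_alternating[OF table_three_cycle(1)[OF T pq xyz product \<open>3 < n\<close>]
          xyz(1)]) auto
qed

lemma commutative_table:
  assumes "loop_table T" "n = length T"
    and "list_all (\<lambda>b. map (\<lambda>r. r ! b) T = T ! b) [0..<n]"
  shows "commutative_on {..<n} (table_op T)"
proof -
  have "map (\<lambda>r. r ! b) T = T ! b" if "b < n" for b
    using assms(3) that by (simp add: list_all_iff)
  then have "T ! a ! b = T ! b ! a" if "a < n" "b < n" for a b
    using that assms(2) by (metis nth_map)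
  then show ?thesis by (simp add: commutative_on_def table_op_def)
qed

text \<open>The following tables were found by computer search.\<close>

definition table_5 :: "nat list list"
  where "table_5 =
    [[0, 1, 2, 3, 4],
     [1, 4, 3, 0, 2],
     [2, 3, 4, 1, 0],
     [3, 2, 0, 4, 1],
     [4, 0, 1, 2, 3]]"

lemma unbreakable_loop_5:
  "unbreakable_loop {..<5} (table_op table_5)" "\<not> associative_on {..<5} (table_op table_5)"
proof -
  have "loop_table table_5" "large_square_orbits table_5" "5 = length table_5" by code_simp+
  then show "unbreakable_loop {..<5} (table_op table_5)" by (intro unbreakable_table)
  have "table_op table_5 (table_op table_5 1 1) 1 \<noteq> table_op table_5 1 (table_op table_5 1 1)"
    by code_simp
  then show "\<not> associative_on {..<5} (table_op table_5)"
    unfolding associative_on_def by fastforce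
qed

definition alternating_table_7 :: "nat list list"
  where "alternating_table_7 =
    [[0, 1, 2, 3, 4, 5, 6],
     [1, 2, 0, 5, 6, 3, 4],
     [2, 0, 3, 6, 1, 4, 5],
     [3, 5, 6, 4, 0, 1, 2],
     [4, 6, 1, 0, 5, 2, 3],
     [5, 3, 4, 1, 2, 6, 0],
     [6, 4, 5, 2, 3, 0, 1]]"

lemma alternating_table_7_loop:
  "unbreakable_loop {..<7} (table_op alternating_table_7)"
  "commutative_on {..<7} (table_op alternating_table_7)"
  "\<not> associative_on {..<7} (table_op alternating_table_7)"
  "multiplication_group {..<7} (table_op alternating_table_7) = alternating_group {..<7}"
proof -
  have T: "loop_table alternating_table_7" "7 = length alternating_table_7" by code_simp+
  have large: "large_square_orbits alternating_table_7" by code_simp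
  have product: "table_product alternating_table_7 1 1 = map (three_cycle 0 2 1) [0..<7]" by code_simp
  have "list_all (\<lambda>b. map (\<lambda>r. r ! b) alternating_table_7 = alternating_table_7 ! b) [0..<7]" by code_simp
  then show comm: "commutative_on {..<7} (table_op alternating_table_7)"
    by (rule commutative_table[OF T])
  show "unbreakable_loop {..<7} (table_op alternating_table_7)"
    using T large by (rule unbreakable_table)
  show "\<not> associative_on {..<7} (table_op alternating_table_7)"
    by (rule table_three_cycle(2)[OF T _ _ _ _ _ _ product]) simp_all
  have "list_all row_parity alternating_table_7" by code_simp
  then show "multiplication_group {..<7} (table_op alternating_table_7) = alternating_group {..<7}"
    using comm by (intro alternating_table[OF T large _ _ _ _ _ _ product]) simp_all
qed

definition alternating_table_9 :: "nat list list"
  where "alternating_table_9 =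
    [[0, 1, 2, 3, 4, 5, 6, 7, 8],
     [1, 2, 7, 5, 0, 4, 8, 6, 3],
     [2, 7, 3, 6, 8, 1, 5, 4, 0],
     [3, 5, 6, 4, 7, 8, 0, 1, 2],
     [4, 0, 8, 7, 5, 3, 1, 2, 6],
     [5, 4, 1, 8, 3, 6, 2, 0, 7],
     [6, 8, 5, 0, 1, 2, 7, 3, 4],
     [7, 6, 4, 1, 2, 0, 3, 8, 5],
     [8, 3, 0, 2, 6, 7, 4, 5, 1]]"

lemma alternating_table_9_loop:
  "unbreakable_loop {..<9} (table_op alternating_table_9)"
  "commutative_on {..<9} (table_op alternating_table_9)"
  "\<not> associative_on {..<9} (table_op alternating_table_9)"
  "multiplication_group {..<9} (table_op alternating_table_9) = alternating_group {..<9}"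
proof -
  have T: "loop_table alternating_table_9" "9 = length alternating_table_9" by code_simp+
  have large: "large_square_orbits alternating_table_9" by code_simp
  have product: "table_product alternating_table_9 1 4 = map (three_cycle 2 3 6) [0..<9]" by code_simp
  have "list_all (\<lambda>b. map (\<lambda>r. r ! b) alternating_table_9 = alternating_table_9 ! b) [0..<9]" by code_simp
  then show comm: "commutative_on {..<9} (table_op alternating_table_9)"
    by (rule commutative_table[OF T])
  show "unbreakable_loop {..<9} (table_op alternating_table_9)"
    using T large by (rule unbreakable_table)
  show "\<not> associative_on {..<9} (table_op alternating_table_9)"
    by (rule table_three_cycle(2)[OF T _ _ _ _ _ _ product]) simp_all
  have "list_all row_parity alternating_table_9" by code_simp
  then show "multiplication_group {..<9} (table_op alternating_table_9) = alternating_group {..<9}"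
    using comm by (intro alternating_table[OF T large _ _ _ _ _ _ product]) simp_all
qed

definition alternating_table_11 :: "nat list list"
  where "alternating_table_11 =
    [[0, 1, 2, 3, 4, 5, 6, 7, 8, 9, 10],
     [1, 2, 4, 6, 10, 3, 5, 9, 0, 7, 8],
     [2, 4, 3, 5, 6, 0, 1, 10, 7, 8, 9],
     [3, 6, 5, 4, 7, 8, 9, 0, 10, 1, 2],
     [4, 10, 6, 7, 5, 9, 8, 1, 2, 0, 3],
     [5, 3, 0, 8, 9, 6, 10, 2, 1, 4, 7],
     [6, 5, 1, 9, 8, 10, 7, 4, 3, 2, 0],
     [7, 9, 10, 0, 1, 2, 4, 8, 5, 3, 6],
     [8, 0, 7, 10, 2, 1, 3, 5, 9, 6, 4],
     [9, 7, 8, 1, 0, 4, 2, 3, 6, 10, 5],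
     [10, 8, 9, 2, 3, 7, 0, 6, 4, 5, 1]]"

lemma alternating_table_11_loop:
  "unbreakable_loop {..<11} (table_op alternating_table_11)"
  "commutative_on {..<11} (table_op alternating_table_11)"
  "\<not> associative_on {..<11} (table_op alternating_table_11)"
  "multiplication_group {..<11} (table_op alternating_table_11) = alternating_group {..<11}"
proof -
  have T: "loop_table alternating_table_11" "11 = length alternating_table_11" by code_simp+
  have large: "large_square_orbits alternating_table_11" by code_simp
  have product: "table_product alternating_table_11 4 9 = map (three_cycle 3 10 9) [0..<11]" by code_simp
  have "list_all (\<lambda>b. map (\<lambda>r. r ! b) alternating_table_11 = alternating_table_11 ! b) [0..<11]" by code_simp
  then show comm: "commutative_on {..<11} (table_op alternating_table_11)"
    by (rule commutative_table[OF T])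
  show "unbreakable_loop {..<11} (table_op alternating_table_11)"
    using T large by (rule unbreakable_table)
  show "\<not> associative_on {..<11} (table_op alternating_table_11)"
    by (rule table_three_cycle(2)[OF T _ _ _ _ _ _ product]) simp_all
  have "list_all row_parity alternating_table_11" by code_simp
  then show "multiplication_group {..<11} (table_op alternating_table_11) = alternating_group {..<11}"
    using comm by (intro alternating_table[OF T large _ _ _ _ _ _ product]) simp_all
qed

definition symmetric_table_7 :: "nat list list"
  where "symmetric_table_7 =
    [[0, 1, 2, 3, 4, 5, 6],
     [1, 2, 0, 5, 6, 3, 4],
     [2, 0, 3, 6, 1, 4, 5],
     [3, 5, 6, 4, 2, 1, 0],
     [4, 6, 1, 2, 5, 0, 3],
     [5, 3, 4, 1, 0, 6, 2],
     [6, 4, 5, 0, 3, 2, 1]]"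

lemma symmetric_table_7_loop:
  "unbreakable_loop {..<7} (table_op symmetric_table_7)"
  "commutative_on {..<7} (table_op symmetric_table_7)"
  "\<not> associative_on {..<7} (table_op symmetric_table_7)"
  "multiplication_group {..<7} (table_op symmetric_table_7) = symmetric_group {..<7}"
proof -
  have T: "loop_table symmetric_table_7" "7 = length symmetric_table_7" by code_simp+
  have large: "large_square_orbits symmetric_table_7" by code_simp
  have product: "table_product symmetric_table_7 1 1 = map (three_cycle 0 2 1) [0..<7]" by code_simp
  have "list_all (\<lambda>b. map (\<lambda>r. r ! b) symmetric_table_7 = symmetric_table_7 ! b) [0..<7]" by code_simp
  then show comm: "commutative_on {..<7} (table_op symmetric_table_7)"
    by (rule commutative_table[OF T])
  show "unbreakable_loop {..<7} (table_op symmetric_table_7)"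
    using T large by (rule unbreakable_table)
  show "\<not> associative_on {..<7} (table_op symmetric_table_7)"
    by (rule table_three_cycle(2)[OF T _ _ _ _ _ _ product]) simp_all
  have "\<not> row_parity (symmetric_table_7 ! 3)" by code_simp
  then show "multiplication_group {..<7} (table_op symmetric_table_7) = symmetric_group {..<7}"
    by (intro symmetric_table[OF T large _ _ _ _ _ _ product, where a = 3]) simp_all
qed

definition symmetric_table_9 :: "nat list list"
  where "symmetric_table_9 =
    [[0, 1, 2, 3, 4, 5, 6, 7, 8],
     [1, 2, 4, 5, 0, 7, 8, 3, 6],
     [2, 4, 3, 6, 8, 0, 1, 5, 7],
     [3, 5, 6, 4, 7, 8, 0, 1, 2],
     [4, 0, 8, 7, 5, 1, 2, 6, 3],
     [5, 7, 0, 8, 1, 6, 3, 2, 4],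
     [6, 8, 1, 0, 2, 3, 7, 4, 5],
     [7, 3, 5, 1, 6, 2, 4, 8, 0],
     [8, 6, 7, 2, 3, 4, 5, 0, 1]]"

lemma symmetric_table_9_loop:
  "unbreakable_loop {..<9} (table_op symmetric_table_9)"
  "commutative_on {..<9} (table_op symmetric_table_9)"
  "\<not> associative_on {..<9} (table_op symmetric_table_9)"
  "multiplication_group {..<9} (table_op symmetric_table_9) = symmetric_group {..<9}"
proof -
  have T: "loop_table symmetric_table_9" "9 = length symmetric_table_9" by code_simp+
  have large: "large_square_orbits symmetric_table_9" by code_simp
  have product: "table_product symmetric_table_9 7 7 = map (three_cycle 0 8 7) [0..<9]" by code_simp
  have "list_all (\<lambda>b. map (\<lambda>r. r ! b) symmetric_table_9 = symmetric_table_9 ! b) [0..<9]" by code_simp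
  then show comm: "commutative_on {..<9} (table_op symmetric_table_9)"
    by (rule commutative_table[OF T])
  show "unbreakable_loop {..<9} (table_op symmetric_table_9)"
    using T large by (rule unbreakable_table)
  show "\<not> associative_on {..<9} (table_op symmetric_table_9)"
    by (rule table_three_cycle(2)[OF T _ _ _ _ _ _ product]) simp_all
  have "\<not> row_parity (symmetric_table_9 ! 4)" by code_simp
  then show "multiplication_group {..<9} (table_op symmetric_table_9) = symmetric_group {..<9}"
    by (intro symmetric_table[OF T large _ _ _ _ _ _ product, where a = 4]) simp_all
qed

definition symmetric_table_11 :: "nat list list"
  where "symmetric_table_11 =
    [[0, 1, 2, 3, 4, 5, 6, 7, 8, 9, 10],
     [1, 2, 4, 6, 10, 3, 5, 9, 0, 7, 8],
     [2, 4, 3, 5, 6, 8, 1, 10, 7, 0, 9],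
     [3, 6, 5, 4, 8, 9, 10, 0, 1, 2, 7],
     [4, 10, 6, 8, 5, 7, 9, 1, 2, 3, 0],
     [5, 3, 8, 9, 7, 6, 0, 2, 10, 1, 4],
     [6, 5, 1, 10, 9, 0, 7, 3, 4, 8, 2],
     [7, 9, 10, 0, 1, 2, 3, 8, 6, 4, 5],
     [8, 0, 7, 1, 2, 10, 4, 6, 9, 5, 3],
     [9, 7, 0, 2, 3, 1, 8, 4, 5, 10, 6],
     [10, 8, 9, 7, 0, 4, 2, 5, 3, 6, 1]]"

lemma symmetric_table_11_loop:
  "unbreakable_loop {..<11} (table_op symmetric_table_11)"
  "commutative_on {..<11} (table_op symmetric_table_11)"
  "\<not> associative_on {..<11} (table_op symmetric_table_11)"
  "multiplication_group {..<11} (table_op symmetric_table_11) = symmetric_group {..<11}"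
proof -
  have T: "loop_table symmetric_table_11" "11 = length symmetric_table_11" by code_simp+
  have large: "large_square_orbits symmetric_table_11" by code_simp
  have product: "table_product symmetric_table_11 4 10 = map (three_cycle 1 2 3) [0..<11]" by code_simp
  have "list_all (\<lambda>b. map (\<lambda>r. r ! b) symmetric_table_11 = symmetric_table_11 ! b) [0..<11]" by code_simp
  then show comm: "commutative_on {..<11} (table_op symmetric_table_11)"
    by (rule commutative_table[OF T])
  show "unbreakable_loop {..<11} (table_op symmetric_table_11)"
    using T large by (rule unbreakable_table)
  show "\<not> associative_on {..<11} (table_op symmetric_table_11)"
    by (rule table_three_cycle(2)[OF T _ _ _ _ _ _ product]) simp_all
  have "\<not> row_parity (symmetric_table_11 ! 2)" by code_simp
  then show "multiplication_group {..<11} (table_op symmetric_table_11) = symmetric_group {..<11}"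
    by (intro symmetric_table[OF T large _ _ _ _ _ _ product, where a = 2]) simp_all
qed

definition symmetric_table_6 :: "nat list list"
  where "symmetric_table_6 =
    [[0, 1, 2, 3, 4, 5],
     [1, 4, 3, 2, 5, 0],
     [2, 3, 5, 4, 0, 1],
     [3, 0, 4, 5, 1, 2],
     [4, 5, 1, 0, 2, 3],
     [5, 2, 0, 1, 3, 4]]"

lemma symmetric_table_6_loop:
  "unbreakable_loop {..<6} (table_op symmetric_table_6)"
  "\<not> associative_on {..<6} (table_op symmetric_table_6)"
  "multiplication_group {..<6} (table_op symmetric_table_6) = symmetric_group {..<6}"
proof -
  have T: "loop_table symmetric_table_6" "6 = length symmetric_table_6" by code_simp+
  have large: "large_square_orbits symmetric_table_6" by code_simp
  have product: "table_product symmetric_table_6 2 5 = map (three_cycle 0 1 5) [0..<6]" by code_simp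
  show "unbreakable_loop {..<6} (table_op symmetric_table_6)"
    using T large by (rule unbreakable_table)
  show "\<not> associative_on {..<6} (table_op symmetric_table_6)"
    by (rule table_three_cycle(2)[OF T _ _ _ _ _ _ product]) simp_all
  have "\<not> row_parity (symmetric_table_6 ! 2)" by code_simp
  then show "multiplication_group {..<6} (table_op symmetric_table_6) = symmetric_group {..<6}"
    by (intro symmetric_table[OF T large _ _ _ _ _ _ product, where a = 2]) simp_all
qed

section \<open>The existence theorem\<close>

lemma odd_loop_alternating:
  assumes "odd n" "7 \<le> n"
  shows "\<exists>op :: nat \<Rightarrow> nat \<Rightarrow> nat. unbreakable_loop {..<n} op \<and> commutative_on {..<n} op \<and>
    multiplication_group {..<n} op = alternating_group {..<n}"
proof (cases "13 \<le> n")
  case True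
  then have n: "even (n - 13)" "n - 13 + 13 = n" using assms(1) by simp_all
  obtain op where "unbreakable_loop {..<n} op" "commutative_on {..<n} op"
    "multiplication_group {..<n} op = alternating_group {..<n}"
    using odd_loop_exists[OF n(1), where t = "evenperm (dbl (n - 13 + 9))"] n(2) by auto
  then show ?thesis by blast
next
  case False
  then have "n \<in> {7, 9, 11}" using assms by auto presburger
  then show ?thesis
    using alternating_table_7_loop alternating_table_9_loop alternating_table_11_loop by blast
qed

lemma odd_loop_symmetric:
  assumes "odd n" "7 \<le> n"
  shows "\<exists>op :: nat \<Rightarrow> nat \<Rightarrow> nat. unbreakable_loop {..<n} op \<and> commutative_on {..<n} op \<and>
    \<not> associative_on {..<n} op \<and> multiplication_group {..<n} op = symmetric_group {..<n}"
proof (cases "13 \<le> n")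
  case True
  then have n: "even (n - 13)" "n - 13 + 13 = n" using assms(1) by simp_all
  obtain op where "unbreakable_loop {..<n} op" "commutative_on {..<n} op"
    "\<not> associative_on {..<n} op" "multiplication_group {..<n} op = symmetric_group {..<n}"
    using odd_loop_exists[OF n(1), where t = "\<not> evenperm (dbl (n - 13 + 9))"] n(2) by auto
  then show ?thesis by blast
next
  case False
  then have "n \<in> {7, 9, 11}" using assms by auto presburger
  then show ?thesis
    using symmetric_table_7_loop symmetric_table_9_loop symmetric_table_11_loop by blast
qed

lemma even_loop_symmetric:
  assumes "even n" "6 \<le> n"
  shows "\<exists>op :: nat \<Rightarrow> nat \<Rightarrow> nat. unbreakable_loop {..<n} op \<and> \<not> associative_on {..<n} op \<and>
    multiplication_group {..<n} op = symmetric_group {..<n}"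
proof (cases "n = 6")
  case True
  then show ?thesis using symmetric_table_6_loop by blast
next
  case False
  then have n: "odd (n - 3)" "5 \<le> n - 3" "n - 3 + 3 = n" using assms by presburger+
  show ?thesis using even_loop_exists[OF n(1,2)] unfolding n(3) by metis
qed

theorem theorem1p1:
  shows "(\<forall>n::nat. n \<ge> 5 \<longrightarrow>
            (\<exists>op :: nat \<Rightarrow> nat \<Rightarrow> nat.
               unbreakable_loop {..<n} op \<and> \<not> associative_on {..<n} op))
       \<and> (\<forall>n::nat. odd n \<and> n \<ge> 7 \<longrightarrow>
            (\<exists>op :: nat \<Rightarrow> nat \<Rightarrow> nat.
               unbreakable_loop {..<n} op \<and> commutative_on {..<n} op \<and>
               multiplication_group {..<n} op = symmetric_group {..<n}) \<and>
            (\<exists>op :: nat \<Rightarrow> nat \<Rightarrow> nat.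
               unbreakable_loop {..<n} op \<and> commutative_on {..<n} op \<and>
               multiplication_group {..<n} op = alternating_group {..<n}))
       \<and> (\<forall>n::nat. even n \<and> n \<ge> 6 \<longrightarrow>
            (\<exists>op :: nat \<Rightarrow> nat \<Rightarrow> nat.
               unbreakable_loop {..<n} op \<and>
               multiplication_group {..<n} op = symmetric_group {..<n}))"
proof (intro conjI allI impI)
  fix n :: nat assume n: "5 \<le> n"
  then have "n = 5 \<or> even n \<and> 6 \<le> n \<or> odd n \<and> 7 \<le> n" by presburger
  then consider "n = 5" | "even n" "6 \<le> n" | "odd n" "7 \<le> n" by blast
  then show "\<exists>op :: nat \<Rightarrow> nat \<Rightarrow> nat. unbreakable_loop {..<n} op \<and> \<not> associative_on {..<n} op"
    using unbreakable_loop_5 odd_loop_symmetric even_loop_symmetric by cases blast+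
next
  fix n :: nat assume "odd n \<and> 7 \<le> n"
  then show "\<exists>op :: nat \<Rightarrow> nat \<Rightarrow> nat. unbreakable_loop {..<n} op \<and> commutative_on {..<n} op \<and>
      multiplication_group {..<n} op = symmetric_group {..<n}"
    using odd_loop_symmetric by blast
next
  fix n :: nat assume "odd n \<and> 7 \<le> n"
  then show "\<exists>op :: nat \<Rightarrow> nat \<Rightarrow> nat. unbreakable_loop {..<n} op \<and> commutative_on {..<n} op \<and>
      multiplication_group {..<n} op = alternating_group {..<n}"
    using odd_loop_alternating by blast
next
  fix n :: nat assume "even n \<and> 6 \<le> n"
  then show "\<exists>op :: nat \<Rightarrow> nat \<Rightarrow> nat. unbreakable_loop {..<n} op \<and>
      multiplication_group {..<n} op = symmetric_group {..<n}"
    using even_loop_symmetric by blast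
qed

end
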